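(* Let $\alpha\le1$ and $\lambda\in[0,1]$. A function $f\in\mathcal{A}$ belongs to $\mathfrak{G}_\alpha^\lambda$ if and only if one (hence all) of the following conditions holds: (1) For all $\zeta$ with $|\zeta|=1$, $\zeta\neq1$, $$f(z)*z\left(\frac{1-\alpha z}{(1-z)^2}-1-\frac{2\lambda\zeta}{1-\zeta}\right)\neq0\quad\text{for all } z\in\mathbb{D}\setminus\{0\}.$$ (2) There is a function $q\in\mathcal{P}$ such that $\operatorname{Re}q(z)\ge1-\lambda$ for $z\in\mathbb{D}$, and $$f(z)=z\int_0^1q\left(t^{1-\alpha}z\right)dt,\quad z\in\mathbb{D}.$$ Consequently, if $f\in\mathfrak{G}_\alpha^\lambda$, then $f(z)/z\prec F_\alpha^\lambda(z)$. (3) There is a probability measure $\mu$ on the unit circle $\partial\mathbb{D}$ such that $$f(z)=z\int_{\partial\mathbb{D}}F_\alpha^\lambda(z\overline{\zeta})\,d\mu(\zeta),\quad z\in\mathbb{D}.$$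
   Context: Let $\mathbb{D}$ be the open unit disk. $\mathcal{A}$ is the set of holomorphic $f:\mathbb{D}\to\mathbb{C}$ with $f(0)=0$, $f'(0)=1$. $\mathcal{P}$ is the set of holomorphic $q$ on $\mathbb{D}$ with $q(0)=1$ and $\operatorname{Re}q>0$. For $\alpha\le1$, $\lambda\in[0,1]$, $$\mathfrak{G}_\alpha^\lambda=\left\{f\in\mathcal{A}:\ \operatorname{Re}\left[\alpha\frac{f(z)}{z}+(1-\alpha)f'(z)\right]\ge1-\lambda,\ z\in\mathbb{D}\setminus\{0\}\right\}.$$ $F_1(z)=\frac{1+z}{1-z}$; for $\alpha<1$, $F_\alpha(z)=\int_0^1F_1(t^{1-\alpha}z)\,dt$; and $F_\alpha^\lambda(z)=\lambda F_\alpha(z)+1-\lambda$. For $f(z)=\sum_{n\ge0}a_nz^n$ and $g(z)=\sum_{n\ge0}b_nz^n$, $f*g(z)=\sum_{n\ge0}a_nb_nz^n$ (Hadamard product). For $f,g$ holomorphic on $\mathbb{D}$, $f\prec g$ (subordination) means $f=g\circ\omega$ for some holomorphic $\omega:\mathbb{D}\to\mathbb{D}$ with $\omega(0)=0$.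
   Formalization: The equivalence with (1) is stated only for λ>0: at λ=0 it is false, since f(z)=z belongs to the class but its Hadamard product with the kernel is identically 0; (2), (3) and the subordination cover all λ in [0,1]. *)

theory Defs
  imports "HOL-Complex_Analysis.Complex_Analysis" "HOL-Probability.Probability"
begin

abbreviation unit_disc :: "complex set" where
  "unit_disc \<equiv> ball 0 1"

definition class_A :: "(complex \<Rightarrow> complex) set" where
  "class_A = {f. f holomorphic_on unit_disc \<and> f 0 = 0 \<and> deriv f 0 = 1}"

definition class_P :: "(complex \<Rightarrow> complex) set" where
  "class_P = {q. q holomorphic_on unit_disc \<and> q 0 = 1 \<and> (\<forall>z\<in>unit_disc. Re (q z) > 0)}"

definition class_G :: "real \<Rightarrow> real \<Rightarrow> (complex \<Rightarrow> complex) set" where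
  "class_G \<alpha> lam = {f \<in> class_A. \<forall>z\<in>unit_disc - {0}.
     Re (of_real \<alpha> * (f z / z) + of_real (1 - \<alpha>) * deriv f z) \<ge> 1 - lam}"

definition F_one :: "complex \<Rightarrow> complex" where
  "F_one z = (1 + z) / (1 - z)"

definition F_fun :: "real \<Rightarrow> complex \<Rightarrow> complex" where
  "F_fun \<alpha> z = (if \<alpha> = 1 then F_one z
     else integral {0..1} (\<lambda>t::real. F_one (of_real (t powr (1 - \<alpha>)) * z)))"

definition F_lam :: "real \<Rightarrow> real \<Rightarrow> complex \<Rightarrow> complex" where
  "F_lam \<alpha> lam z = of_real lam * F_fun \<alpha> z + of_real (1 - lam)"

definition hadamard :: "(complex \<Rightarrow> complex) \<Rightarrow> (complex \<Rightarrow> complex) \<Rightarrow> complex \<Rightarrow> complex" where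
  "hadamard f g z =
     (\<Sum>n. fps_nth (fps_expansion f 0) n * fps_nth (fps_expansion g 0) n * z ^ n)"

definition subordinate :: "(complex \<Rightarrow> complex) \<Rightarrow> (complex \<Rightarrow> complex) \<Rightarrow> bool" where
  "subordinate f g \<longleftrightarrow> f holomorphic_on unit_disc \<and> g holomorphic_on unit_disc \<and>
     (\<exists>\<omega>. \<omega> holomorphic_on unit_disc \<and> \<omega> ` unit_disc \<subseteq> unit_disc \<and> \<omega> 0 = 0 \<and>
          (\<forall>z\<in>unit_disc. f z = g (\<omega> z)))"

(* f(z)/z with its removable singularity at 0 filled in (the limit is f'(0) when f(0) = 0) *)
definition quot_id :: "(complex \<Rightarrow> complex) \<Rightarrow> complex \<Rightarrow> complex" where
  "quot_id f z = (if z = 0 then deriv f 0 else f z / z)"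

(* For lam = 0 this kernel has no linear term and class_G consists (on the disc) of the
   identity alone, whose Hadamard product with the kernel is 0.  The nonvanishing criterion
   therefore fails at lam = 0 and characterizes class_G only for lam > 0. *)
definition conv_kernel :: "real \<Rightarrow> real \<Rightarrow> complex \<Rightarrow> complex \<Rightarrow> complex" where
  "conv_kernel \<alpha> lam \<zeta> z =
     z * ((1 - of_real \<alpha> * z) / (1 - z)\<^sup>2 - 1 - 2 * of_real lam * \<zeta> / (1 - \<zeta>))"

end

(* With b = 1 - alpha and E g = g + b z g', a function f = z g lies in class_G iff
   Re (E g) >= 1 - lam.  The operator E multiplies the n-th Taylor coefficient by 1 + b n, and
   g z is recovered as the integral of E g (t^b z) over 0 <= t <= 1, which is (2); the Hadamard
   product in (1) equals z (E g z - c) with c running through the line Re c = 1 - lam, so (1)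
   follows from connectedness and the open mapping theorem; (3) is the Herglotz representation
   of E g transported through E, where E F_fun = F_one.  Subordination needs no convexity of
   F_fun: E F_fun = F_one gives Re (F_fun' / F_one') > 0, hence univalence by
   Noshiro-Warschawski, and Jack's lemma applied to F_fun^-1 o g does the rest. *)

theory Submission
  imports Defs
begin

section \<open>Power series on the unit disc and the operator \<open>g + b z g'\<close>\<close>

text \<open>The operator E serves every part because it is diagonal on Taylor coefficients with
  factors \<open>1 + b n >= 1\<close>. So it is invertible on the holomorphic functions of the disc,
  and it commutes with averaging over rotations, which multiplies coefficients by moments of the
  measure. No differentiation under an integral sign is ever made: identities are checked after
  applying E and pulled back by uniqueness. Two obstacles shape the rest. For \<open>lam = 0\<close>
  the function \<open>F_lam\<close> is constant and has no inverse, so E g is written as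
  \<open>lam p + (1 - lam)\<close> with p in \<open>class_P\<close>, and what holds for p is carried
  over by the affine map. Moreover, a solution of E g = p is not known in advance to take its values
  in the image of \<open>F_fun\<close>, where the inverse lives; the bound from Jack's lemma is
  proved on the disc reaching to the nearest point of escape, and compactness excludes such a point.
  The Herglotz measure is a weak limit. It is built on the real line, as a distribution of angles,
  and moved to the circle only after the limit.\<close>

lemma coeffs_sums:
  assumes "g holomorphic_on unit_disc" "z \<in> unit_disc"
  shows "(\<lambda>n. fps_nth (fps_expansion g 0) n * z ^ n) sums g z"
  using holomorphic_power_series[OF assms] by (simp add: fps_expansion_def)

lemma coeffs_unique:
  assumes "\<And>z. z \<in> unit_disc \<Longrightarrow> (\<lambda>n. a n * z ^ n) sums g z"
  shows "fps_nth (fps_expansion g 0) n = a n"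
proof -
  have "g has_fps_expansion Abs_fps a"
  proof (rule has_fps_expansionI)
    have "eventually (\<lambda>u. u \<in> unit_disc) (nhds (0::complex))"
      by (intro eventually_nhds_in_open) auto
    then show "eventually (\<lambda>u. (\<lambda>n. fps_nth (Abs_fps a) n * u ^ n) sums g u) (nhds 0)"
      by eventually_elim (simp add: assms)
  qed
  then show ?thesis
    by (metis fps_expansion_eqI fps_nth_Abs_fps)
qed

lemma power_series_derivative:
  assumes "\<And>z. z \<in> unit_disc \<Longrightarrow> (\<lambda>n. a n * z ^ n) sums g z" and z: "z \<in> unit_disc"
  shows "g field_differentiable at z" "(\<lambda>n. of_nat n * a n * z ^ n) sums (z * deriv g z)"
proof -
  obtain r where r: "norm z < r" "r < 1" using dense[of "norm z" 1] z by auto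
  have "complex_of_real r \<in> unit_disc" using r by simp (smt (verit) norm_ge_zero)
  then have "summable (\<lambda>n. a n * of_real r ^ n)" using assms(1) sums_summable by blast
  then obtain k k' where k: "\<And>z. cmod z < r \<Longrightarrow>
      ((\<lambda>n. a n * z^n) sums k z) \<and> ((\<lambda>n. of_nat n * a n * z^(n-1)) sums k' z) \<and> (k has_field_derivative k' z) (at z)"
    using power_series_and_derivative_0[of a r] by auto
  have "k w = g w" if "w \<in> ball 0 r" for w
    using k[of w] assms(1)[of w] that r by (auto intro: sums_unique2)
  then have *: "(g has_field_derivative k' z) (at z)"
    using k[of z] r by (intro has_field_derivative_transform_within_open[of k _ z "ball 0 r" g]) auto
  show "g field_differentiable at z" using * field_differentiable_def by blast
  have "(\<lambda>n. z * (of_nat n * a n * z^(n-1))) sums (z * k' z)" using k[of z] r sums_mult by blast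
  moreover have "z * (of_nat n * a n * z^(n-1)) = of_nat n * a n * z^n" for n
    by (cases n) auto
  ultimately show "(\<lambda>n. of_nat n * a n * z ^ n) sums (z * deriv g z)"
    unfolding DERIV_imp_deriv[OF *] by (simp only:)
qed

lemma power_series_holomorphic_on:
  assumes "\<And>z. z \<in> unit_disc \<Longrightarrow> (\<lambda>n. a n * z ^ n) sums g z"
  shows "g holomorphic_on unit_disc"
  using power_series_derivative(1)[OF assms] by (auto simp: holomorphic_on_open field_differentiable_def)

lemma coeffs_abs_summable:
  fixes z :: complex
  assumes "\<And>z. z \<in> unit_disc \<Longrightarrow> (\<lambda>n. a n * z ^ n) sums g z" and z: "z \<in> unit_disc"
  shows "summable (\<lambda>n. norm (a n * z ^ n))"
proof -
  obtain r where r: "norm z < r" "r < 1" using dense[of "norm z" 1] z by auto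
  have "complex_of_real r \<in> unit_disc" using r by simp (smt (verit) norm_ge_zero)
  then have "summable (\<lambda>n. a n * of_real r ^ n)" using assms(1) sums_summable by blast
  then show ?thesis by (rule powser_insidea) (use r in auto)
qed

definition euler_op :: "real \<Rightarrow> (complex \<Rightarrow> complex) \<Rightarrow> complex \<Rightarrow> complex" where
  "euler_op b g z = g z + of_real b * z * deriv g z"

lemma euler_op_sums:
  assumes "\<And>z. z \<in> unit_disc \<Longrightarrow> (\<lambda>n. a n * z ^ n) sums g z" and z: "z \<in> unit_disc"
  shows "(\<lambda>n. of_real (1 + b * real n) * a n * z ^ n) sums euler_op b g z"
proof -
  have "(\<lambda>n. a n * z ^ n + of_real b * (of_nat n * a n * z ^ n)) sums (g z + of_real b * (z * deriv g z))"
    by (intro sums_add sums_mult power_series_derivative(2) assms)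
  then show ?thesis by (simp add: euler_op_def algebra_simps)
qed

lemma euler_op_holomorphic:
  assumes "g holomorphic_on unit_disc"
  shows "euler_op b g holomorphic_on unit_disc"
  unfolding euler_op_def[abs_def] by (intro holomorphic_intros assms) auto

text \<open>Dividing the n-th coefficient by \<open>1 + b n >= 1\<close> cannot increase it, so the
  new series still converges on the whole disc. This produces holomorphic solutions that the
  integral formula then identifies with functions defined by integrals.\<close>

lemma euler_op_solvable:
  assumes q: "q holomorphic_on unit_disc" and b: "0 \<le> b"
  obtains g where "g holomorphic_on unit_disc" "\<And>z. z \<in> unit_disc \<Longrightarrow> euler_op b g z = q z"
proof -
  define c where "c = fps_nth (fps_expansion q 0)"
  define a where "a n = c n / of_real (1 + b * real n)" for n
  have pos: "1 + b * real n \<ge> 1" for n using b by simp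
  have c: "(\<lambda>n. c n * z ^ n) sums q z" if "z \<in> unit_disc" for z
    unfolding c_def using coeffs_sums[OF q that] .
  have a: "(\<lambda>n. a n * z ^ n) sums (\<Sum>n. a n * z ^ n)" if "z \<in> unit_disc" for z
  proof (rule summable_sums, rule summable_comparison_test'[where N=0])
    show "summable (\<lambda>n. norm (c n * z ^ n))" by (rule coeffs_abs_summable[OF c that])
    fix n
    have "norm (a n) \<le> norm (c n)"
      unfolding a_def norm_divide norm_of_real using pos[of n]
      by (intro divide_le_eq[THEN iffD2]) (auto intro!: mult_right_mono mult_le_cancel_left1[THEN iffD2])
    then show "norm (a n * z ^ n) \<le> norm (c n * z ^ n)"
      by (simp add: norm_mult mult_right_mono)
  qed
  have eq: "of_real (1 + b * real n) * a n = c n" for n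
    unfolding a_def using pos[of n] by (metis nonzero_mult_div_cancel_left not_one_le_zero of_real_eq_0_iff times_divide_eq_right)
  show ?thesis
  proof
    show "(\<lambda>z. \<Sum>n. a n * z ^ n) holomorphic_on unit_disc" by (rule power_series_holomorphic_on[OF a])
    show "euler_op b (\<lambda>z. \<Sum>n. a n * z ^ n) z = q z" if "z \<in> unit_disc" for z
      using euler_op_sums[OF a that, of b] c[OF that] unfolding eq by (rule sums_unique2)
  qed
qed

lemma powr_mult_in_disc:
  fixes z :: complex
  assumes "0 \<le> b" "0 \<le> t" "t \<le> 1" "z \<in> unit_disc"
  shows "of_real (t powr b) * z \<in> unit_disc"
proof -
  have "t powr b \<le> 1" using assms powr_mono2[of b t 1] by simp
  then have "t powr b * norm z \<le> norm z" by (simp add: mult_left_le_one_le)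
  then show ?thesis using assms by (simp add: norm_mult)
qed

text \<open>The chain rule gives \<open>t * g (t^b z)\<close> the derivative
  \<open>euler_op b g (t^b z)\<close> in t, so this is the fundamental theorem of calculus.\<close>

lemma euler_op_integral:
  assumes g: "g holomorphic_on unit_disc" and b: "0 \<le> b" and z: "z \<in> unit_disc"
  shows "((\<lambda>t. euler_op b g (of_real (t powr b) * z)) has_integral g z) {0..1}"
proof -
  let ?u = "\<lambda>t::real. of_real (t powr b) * z"
  define F where "F t = of_real t * g (?u t)" for t
  have u: "?u t \<in> unit_disc" if "t \<in> {0..1}" for t
    using powr_mult_in_disc[OF b _ _ z, of t] that by auto
  \<comment> \<open>Only interior derivatives are used: at \<open>t = 0\<close> the factor
    \<open>t powr (b - 1)\<close> blows up for \<open>0 < b < 1\<close>.\<close>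
  have "((\<lambda>t. euler_op b g (?u t)) has_integral F 1 - F 0) {0..1}"
  proof (rule fundamental_theorem_of_calculus_interior)
    show der: "(F has_vector_derivative euler_op b g (?u t)) (at t)" if "t \<in> {0<..<1}" for t
    proof -
      have t: "0 < t" "t \<in> {0..1}" using that by auto
      have "(g has_field_derivative deriv g (?u t)) (at (?u t))"
        using g u[OF t(2)] by (simp add: holomorphic_derivI)
      moreover have "(?u has_vector_derivative (of_real (b * t powr (b - 1)) * z)) (at t)"
        using t by (auto intro!: derivative_eq_intros has_vector_derivative_mult_left has_vector_derivative_of_real simp: powr_diff)
      ultimately have "((g \<circ> ?u) has_vector_derivative (of_real (b * t powr (b - 1)) * z) * deriv g (?u t)) (at t)"
        by (intro field_vector_diff_chain_at)
      then have "(F has_vector_derivative of_real t * ((of_real (b * t powr (b - 1)) * z) * deriv g (?u t)) + 1 * g (?u t)) (at t)"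
        unfolding F_def by (intro has_vector_derivative_mult) (auto simp: o_def intro: derivative_eq_intros)
      moreover have "of_real t * ((of_real (b * t powr (b - 1)) * z) * deriv g (?u t)) + 1 * g (?u t) = euler_op b g (?u t)"
      proof -
        have "t * t powr (b - 1) = t powr b" using t by (simp add: powr_diff)
        then have "complex_of_real t * of_real (t powr (b - 1)) = of_real (t powr b)" by (metis of_real_mult)
        then show ?thesis unfolding euler_op_def by (simp add: algebra_simps)
      qed
      ultimately show ?thesis by simp
    qed
    have sub: "?u ` {0..1} \<subseteq> cball 0 (norm z)"
    proof -
      have "t powr b * cmod z \<le> cmod z" if "t \<in> {0..1}" for t
        using that b powr_mono2[of b t 1] by (simp add: mult_left_le_one_le)
      then show ?thesis by (auto simp: norm_mult)
    qed
    have "compact (g ` cball 0 (norm z))"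
      using z by (intro compact_continuous_image holomorphic_on_imp_continuous_on
         holomorphic_on_subset[OF g]) auto
    then obtain B where B: "\<And>w. w \<in> cball 0 (norm z) \<Longrightarrow> norm (g w) \<le> B"
      using compact_imp_bounded bounded_iff by (metis imageI)
    show "continuous_on {0..1} F"
    proof -
      have "continuous (at t within {0..1}) F" if "t \<in> {0..1}" for t
      proof (cases "t = 0")
        case False
        have "isCont g (?u t)" using g u[OF that]
          using continuous_on_eq_continuous_at holomorphic_on_imp_continuous_on open_ball by blast
        moreover have "isCont ?u t" using False that by (intro continuous_intros) auto
        ultimately have "isCont (\<lambda>t. g (?u t)) t"  using isCont_o2 by blast
        then have "isCont F t" unfolding F_def by (intro continuous_intros)
        then show ?thesis using continuous_at_imp_continuous_at_within by blast
      next
        \<comment> \<open>For \<open>b = 0\<close> the map \<open>t powr b\<close> jumps at 0, since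
          \<open>0 powr 0 = 0\<close>. Continuity of F there comes from the factor t and the bound B
          of g on the closed disc of radius |z|.\<close>
        case True
        have "(F \<longlongrightarrow> 0) (at 0 within {0..1})"
        proof (rule Lim_null_comparison)
          show "((\<lambda>t. t * B) \<longlongrightarrow> 0) (at 0 within {0..1})"
            by (auto intro!: tendsto_eq_intros)
          show "\<forall>\<^sub>F t in at 0 within {0..1}. norm (F t) \<le> t * B"
            unfolding eventually_at_filter F_def using B sub
            by (intro always_eventually) (auto simp: norm_mult image_subset_iff intro!: mult_left_mono)
        qed
        then show ?thesis using True by (simp add: continuous_within F_def)
      qed
      then show ?thesis using continuous_on_eq_continuous_within by blast
    qed
  qed auto
  then show ?thesis by (simp add: F_def)
qed

lemma euler_op_unique_integral:
  assumes "g holomorphic_on unit_disc" "0 \<le> b" "\<And>z. z \<in> unit_disc \<Longrightarrow> euler_op b g z = q z" "z \<in> unit_disc"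
  shows "((\<lambda>t. q (of_real (t powr b) * z)) has_integral g z) {0..1}"
  using euler_op_integral[OF assms(1,2,4)]
  by (rule has_integral_cong[THEN iffD1, rotated]) (use assms powr_mult_in_disc in auto)

section \<open>Univalence of \<open>F_fun\<close>\<close>

lemma Re_of_real_mult: "Re (of_real c * w) = c * Re w"
  by simp

lemma Re_numeral_mult: "Re (2 * w) = 2 * Re w"
  by simp

lemma disc_one_minus_nz: "z \<in> unit_disc \<Longrightarrow> 1 - z \<noteq> 0"
  by auto

lemma F_one_holomorphic: "F_one holomorphic_on unit_disc"
  unfolding F_one_def[abs_def] by (intro holomorphic_intros) auto

lemma Re_inverse_pos: "0 < Re x \<Longrightarrow> 0 < Re (inverse x)"
  by (auto simp: inverse_complex.simps intro!: divide_pos_pos add_pos_nonneg)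

lemma Re_F_one_pos:
  assumes "z \<in> unit_disc"
  shows "0 < Re (F_one z)"
proof -
  have "(norm z)\<^sup>2 < 1" using assms by (simp add: power_less_one_iff abs_square_less_1)
  then have "(Re z)\<^sup>2 + (Im z)\<^sup>2 < 1" by (simp add: cmod_power2)
  moreover have "Re ((1 + z) * cnj (1 - z)) = 1 - ((Re z)\<^sup>2 + (Im z)\<^sup>2)"
    by (simp add: algebra_simps power2_eq_square)
  moreover have "F_one z = ((1 + z) * cnj (1 - z)) / of_real ((norm (1 - z))\<^sup>2)"
    unfolding F_one_def by (subst complex_div_cnj) simp
  moreover have "0 < (norm (1 - z))\<^sup>2" using disc_one_minus_nz[OF assms] by simp
  ultimately show ?thesis by (simp only: Re_divide_of_real) simp
qed

text \<open>The expression is the reciprocal of the average of \<open>F_one u\<close> and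
  \<open>F_one a\<close>, and averages and reciprocals stay in the right half-plane.\<close>

lemma Re_F_one_mean_pos:
  assumes "u \<in> unit_disc" "a \<in> unit_disc"
  shows "0 < Re ((1 - u) * (1 - a) / (1 - u * a))"
proof -
  have "norm (u * a) < 1" using assms by (simp add: norm_mult) (metis mult_strict_mono' mult_1 norm_ge_zero)
  then have nz: "1 - u * a \<noteq> 0" "1 - u \<noteq> 0" "1 - a \<noteq> 0" using assms by auto
  have "(F_one u + F_one a) / 2 = (1 - u * a) / ((1 - u) * (1 - a))"
    unfolding F_one_def using nz by (simp add: divide_simps) algebra
  then have "(1 - u) * (1 - a) / (1 - u * a) = inverse ((F_one u + F_one a) / 2)"
    by (simp only: inverse_divide)
  moreover have "0 < Re ((F_one u + F_one a) / 2)" using assms[THEN Re_F_one_pos] by simp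
  ultimately show ?thesis using Re_inverse_pos by metis
qed

text \<open>Since F_one'(a) = 2 / (1 - a)^2, this computes (F_one a - F_one (u a)) / (a F_one'(a)).
  The denominator is the outward normal at \<open>F_one a\<close> to the image of the circle through
  a, so by \<open>Re_F_one_mean_pos\<close> the point \<open>F_one (u * a)\<close> lies on the inner
  side of the tangent when u is in the disc.\<close>

lemma F_one_diff:
  assumes "a \<in> unit_disc" "u * a \<in> unit_disc"
  shows "(F_one a - F_one (u * a)) * (1 - a)\<^sup>2 = 2 * a * ((1 - u) * (1 - a) / (1 - u * a))"
proof -
  have eq: "F_one a - F_one (u * a) = 2 * a * (1 - u) / ((1 - a) * (1 - u * a))"
    unfolding F_one_def using assms[THEN disc_one_minus_nz] by (simp add: divide_simps) algebra
  show ?thesis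
    unfolding eq using assms[THEN disc_one_minus_nz] by (simp add: divide_simps power2_eq_square)
qed

lemma F_one_inverse:
  assumes "0 < Re w"
  shows "(w - 1) / (w + 1) \<in> unit_disc" "F_one ((w - 1) / (w + 1)) = w" "w + 1 \<noteq> 0"
proof -
  show nz: "w + 1 \<noteq> 0" using assms by (auto simp: complex_eq_iff)
  have "(norm (w - 1))\<^sup>2 < (norm (w + 1))\<^sup>2"
    using assms unfolding cmod_power2 by (simp add: power2_eq_square algebra_simps)
  then have "norm (w - 1) < norm (w + 1)" by (rule power_less_imp_less_base) simp
  then show "(w - 1) / (w + 1) \<in> unit_disc" using nz by (simp add: norm_divide)
  have "1 + (w - 1) / (w + 1) = 2 * w / (w + 1)" "1 - (w - 1) / (w + 1) = 2 / (w + 1)"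
    using nz by (auto simp: field_simps)
  then show "F_one ((w - 1) / (w + 1)) = w" using nz by (simp add: F_one_def)
qed

text \<open>With d = y - x, the real part of cnj d * g has derivative |d|^2 Re g' > 0 along the
  segment from x to y, so its values at the two ends differ.\<close>

lemma Noshiro_Warschawski:
  fixes g :: "complex \<Rightarrow> complex"
  assumes "convex S" and der: "\<And>z. z \<in> S \<Longrightarrow> (g has_field_derivative g' z) (at z)"
    and pos: "\<And>z. z \<in> S \<Longrightarrow> 0 < Re (g' z)"
  shows "inj_on g S"
proof (rule inj_onI, rule ccontr)
  fix x y assume xy: "x \<in> S" "y \<in> S" "g x = g y" "x \<noteq> y"
  define d where "d = y - x"
  define p where "p t = x + of_real t * d" for t :: real
  define r where "r t = Re (cnj d * g (p t))" for t
  have "r 0 < r 1"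
  proof (rule DERIV_pos_imp_increasing[of 0 1 r])
    fix t :: real assume t: "0 \<le> t" "t \<le> 1"
    have "p t = (1 - t) *\<^sub>R x + t *\<^sub>R y" by (simp add: p_def d_def scaleR_conv_of_real algebra_simps)
    then have pS: "p t \<in> S" using convexD_alt[OF \<open>convex S\<close> xy(1,2)] t by simp
    have "(p has_vector_derivative d) (at t)"
      unfolding p_def by (auto intro!: derivative_eq_intros has_vector_derivative_mult_left[of _ 1, simplified])
    then have "((g \<circ> p) has_vector_derivative d * g' (p t)) (at t)"
      by (rule field_vector_diff_chain_at) (rule der[OF pS])
    then have "((\<lambda>t. Re (cnj d * (g \<circ> p) t)) has_vector_derivative Re (cnj d * (d * g' (p t)))) (at t)"
      by (intro bounded_linear.has_vector_derivative[OF bounded_linear_Re] has_vector_derivative_mult_right)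
    then have "DERIV r t :> Re (cnj d * (d * g' (p t)))"
      unfolding r_def by (simp add: has_real_derivative_iff_has_vector_derivative o_def)
    moreover have "cnj d * (d * g' (p t)) = of_real ((norm d)\<^sup>2) * g' (p t)"
      using complex_norm_square[of d] by (simp add: mult_ac)
    moreover have "0 < (norm d)\<^sup>2" using xy by (simp add: d_def)
    ultimately show "\<exists>y. DERIV r t :> y \<and> 0 < y" using pos[OF pS]
      by (intro exI[of _ "(norm d)\<^sup>2 * Re (g' (p t))"]) simp
  qed simp
  moreover have "r 0 = r 1" using xy by (simp add: r_def p_def d_def)
  ultimately show False by simp
qed

text \<open>Equivalently \<open>Re (H' / F_one') > 0\<close>: the integral formula for \<open>H\<close> turns
  \<open>b z H' z = F_one z - H z\<close> into an average of \<open>F_one z - F_one (s z)\<close>, \<open>s = t powr b\<close>.\<close>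

lemma Re_deriv_euler_solution_pos:
  assumes H: "H holomorphic_on unit_disc" and b: "0 \<le> b"
    and eu: "\<And>z. z \<in> unit_disc \<Longrightarrow> euler_op b H z = F_one z" and z: "z \<in> unit_disc"
  shows "0 < Re (deriv H z * (1 - z)\<^sup>2)"
proof -
  have dF: "(F_one has_field_derivative 2 / (1 - z)\<^sup>2) (at z)" if "z \<in> unit_disc" for z
    unfolding F_one_def[abs_def] using disc_one_minus_nz[OF that]
    by (auto intro!: derivative_eq_intros simp: field_simps power2_eq_square)
  \<comment> \<open>The averaging argument divides by z and gets its strict sign from
    \<open>b > 0\<close>. For \<open>b = 0\<close> one has H = F_one; at the origin, differentiating
    E H = F_one gives (1 + b) H'(0) = 2.\<close>
  consider "b = 0" | "z = 0" | "b > 0" "z \<noteq> 0" using b by linarith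
  then show ?thesis
  proof cases
    case 1
    have "(H has_field_derivative 2 / (1 - z)\<^sup>2) (at z)"
      using eu 1 z by (intro has_field_derivative_transform_within_open[OF dF[OF z], of unit_disc]) (auto simp: euler_op_def)
    then have "deriv H z = 2 / (1 - z)\<^sup>2" by (rule DERIV_imp_deriv)
    then show ?thesis using disc_one_minus_nz[OF z] by simp
  next
    case 2
    have dH: "(H has_field_derivative deriv H 0) (at 0)"
      "(deriv H has_field_derivative deriv (deriv H) 0) (at 0)"
      using holomorphic_derivI[OF H, of 0] holomorphic_derivI[OF holomorphic_deriv[OF H], of 0] by auto
    have "(euler_op b H has_field_derivative deriv H 0 + of_real b * deriv H 0) (at 0)"
      unfolding euler_op_def[abs_def] by (rule derivative_eq_intros dH | simp)+
    then have "(F_one has_field_derivative deriv H 0 + of_real b * deriv H 0) (at 0)"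
      by (rule has_field_derivative_transform_within_open[of _ _ _ unit_disc]) (auto simp: eu)
    then have "deriv H 0 + of_real b * deriv H 0 = 2" using dF[of 0] DERIV_unique by fastforce
    then have "of_real (1 + b) * deriv H 0 = 2" by (simp add: algebra_simps)
    then have "Re (of_real (1 + b) * deriv H 0) = 2" by simp
    then have "(1 + b) * Re (deriv H 0) = 2" by simp
    then show ?thesis using 2 b by (simp add: zero_less_mult_iff) (smt (verit) zero_less_mult_iff)
  next
    case 3
    let ?s = "\<lambda>t::real. complex_of_real (t powr b)"
    let ?f = "\<lambda>t. (1 - ?s t) * (1 - z) / (1 - ?s t * z)"
    have s: "?s t * z \<in> unit_disc" if "t \<in> {0..1}" for t
      using powr_mult_in_disc[OF b _ _ z] that by auto
    have "((\<lambda>t. F_one z - F_one (?s t * z)) has_integral F_one z - H z) {0..1}"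
      using has_integral_const_real[of "F_one z" 0 1] euler_op_unique_integral[OF H b eu z]
      by (intro has_integral_diff) auto
    then have "((\<lambda>t. (F_one z - F_one (?s t * z)) * ((1 - z)\<^sup>2 / (2 * z))) has_integral
        (F_one z - H z) * ((1 - z)\<^sup>2 / (2 * z))) {0..1}"
      by (rule has_integral_mult_left)
    moreover have "(F_one z - F_one (?s t * z)) * ((1 - z)\<^sup>2 / (2 * z)) = ?f t" if "t \<in> {0..1}" for t
    proof -
      have "(F_one z - F_one (?s t * z)) * ((1 - z)\<^sup>2 / (2 * z)) =
          (F_one z - F_one (?s t * z)) * (1 - z)\<^sup>2 / (2 * z)" by simp
      then show ?thesis unfolding F_one_diff[OF z s[OF that]] using 3 by simp
    qed
    moreover have "(F_one z - H z) * ((1 - z)\<^sup>2 / (2 * z)) = of_real (b / 2) * (deriv H z * (1 - z)\<^sup>2)"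
      unfolding eu[OF z, symmetric] euler_op_def using 3 by simp
    ultimately have int: "(?f has_integral of_real (b / 2) * (deriv H z * (1 - z)\<^sup>2)) {0..1}"
      by (metis (no_types, lifting) has_integral_cong)
    let ?I = "Re (of_real (b / 2) * (deriv H z * (1 - z)\<^sup>2))"
    have I: "((\<lambda>t. Re (?f t)) has_integral ?I) {0..1}"
      using has_integral_linear[OF int bounded_linear_Re] by (simp add: o_def)
    have pos: "0 < Re (?f t)" if "0 \<le> t" "t < 1" for t
    proof (rule Re_F_one_mean_pos[OF _ z])
      have "t powr b < 1" using that 3 powr_less_mono2[of b t 1] by simp
      then show "?s t \<in> unit_disc" by simp
    qed
    have nonneg: "0 \<le> Re (?f t)" if "t \<in> {0..1}" for t
      using pos[of t] that by (cases "t = 1") auto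
    \<comment> \<open>Integration alone gives only a nonnegative value. The integrand vanishes at
      \<open>t = 1\<close>, but being continuous and positive at 1/2 it cannot have integral
      0.\<close>
    have "?I \<noteq> 0"
    proof
      assume "?I = 0"
      moreover have "continuous_on {0..1} (\<lambda>t. Re (?f t))"
        using 3 s disc_one_minus_nz by (intro continuous_intros continuous_on_powr') auto
      ultimately have "Re (?f (1/2)) = 0"
        using I nonneg has_integral_0_cbox_imp_0[of 0 "1::real" "\<lambda>t. Re (?f t)" "1/2"]
        by (auto simp: box_real)
      then show False using pos[of "1/2"] by simp
    qed
    then have "0 < ?I" using has_integral_nonneg[OF I nonneg] by linarith
    then show ?thesis using 3 by (simp add: zero_less_mult_iff)
  qed
qed

text \<open>In the coordinate w = F_one z the domain is a half-plane, hence convex, and the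
  derivative of H becomes H'(z) (1 - z)^2 / 2, because 1 - z = 2 / (w + 1).
  \<open>Re_deriv_euler_solution_pos\<close> is exactly the positivity of its real part.\<close>

lemma euler_solution_inj_on:
  assumes H: "H holomorphic_on unit_disc" and b: "0 \<le> b"
    and eu: "\<And>z. z \<in> unit_disc \<Longrightarrow> euler_op b H z = F_one z"
  shows "inj_on H unit_disc"
proof -
  let ?k = "\<lambda>w::complex. (w - 1) / (w + 1)"
  have "inj_on (\<lambda>w. H (?k w)) {w. 0 < Re w}"
  proof (rule Noshiro_Warschawski)
    show "convex {w. 0 < Re w}" by (rule convex_halfspace_Re_gt)
    fix w assume "w \<in> {w. 0 < Re w}"
    then have w: "0 < Re w" by simp
    let ?d = "deriv H (?k w) * (2 / (w + 1)\<^sup>2)"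
    have "(?k has_field_derivative 2 / (w + 1)\<^sup>2) (at w)"
      using F_one_inverse(3)[OF w]
      by (auto intro!: derivative_eq_intros simp: power2_eq_square)
    then show "((\<lambda>w. H (?k w)) has_field_derivative ?d) (at w)"
      using holomorphic_derivI[OF H _ F_one_inverse(1)[OF w]] by (intro DERIV_chain2) auto
    have "2 * ?d = deriv H (?k w) * (1 - ?k w)\<^sup>2"
    proof -
      have "1 - ?k w = 2 / (w + 1)" using F_one_inverse(3)[OF w] by (simp add: field_simps)
      then show ?thesis by (simp add: power_divide)
    qed
    moreover have "0 < Re (deriv H (?k w) * (1 - ?k w)\<^sup>2)"
      by (rule Re_deriv_euler_solution_pos[OF H b eu F_one_inverse(1)[OF w]])
    ultimately have "0 < Re (2 * ?d)" by simp
    moreover have "Re (2 * ?d) = 2 * Re ?d" by (rule Re_numeral_mult)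
    ultimately show "0 < Re ?d" by linarith
  qed
  moreover have "?k (F_one z) = z" if "z \<in> unit_disc" for z
    using disc_one_minus_nz[OF that] by (simp add: F_one_def field_simps)
  ultimately show ?thesis
    using Re_F_one_pos unfolding inj_on_def by (metis mem_Collect_eq)
qed

section \<open>Jack's lemma and subordination\<close>

text \<open>The quotient z w'(z) / w(z) is the derivative of log w with respect to log z. It is real
  because |w| is stationary at z along the circle, and at least 1 because the maximum principle for
  w(u) / u gives |w(t z)| <= t |w z| for 0 <= t <= 1.\<close>

lemma Jack_lemma:
  assumes w: "w holomorphic_on ball 0 R" and w0: "w 0 = 0"
    and z: "z \<in> ball 0 R" "w z \<noteq> 0"
    and max: "\<And>u. norm u = norm z \<Longrightarrow> norm (w u) \<le> norm (w z)"
  obtains m :: real where "1 \<le> m" "z * deriv w z = of_real m * w z"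
proof -
  have z0: "z \<noteq> 0" using w0 z by auto
  have dw: "(w has_field_derivative deriv w z) (at z)" using holomorphic_derivI[OF w _ z(1)] by simp
  \<comment> \<open>P is |w z|^2 times the quotient z w'(z) / w(z), so it must be shown real and at
    least |w z|^2.\<close>
  define P where "P = cnj (w z) * (z * deriv w z)"
  have der: "DERIV (\<lambda>t. (norm (w (p t)))\<^sup>2) s :> 2 * Re (cnj (w z) * (d * deriv w z))"
    if p: "(p has_vector_derivative d) (at s)" "p s = z" for p :: "real \<Rightarrow> complex" and d s
  proof -
    have "((w \<circ> p) has_vector_derivative d * deriv w z) (at s)"
      using dw p by (intro field_vector_diff_chain_at) auto
    then have D: "((\<lambda>t. w (p t)) has_vector_derivative d * deriv w z) (at s)" by (simp add: o_def)
    have "((\<lambda>t. Re (w (p t))) has_vector_derivative Re (d * deriv w z)) (at s)"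
      "((\<lambda>t. Im (w (p t))) has_vector_derivative Im (d * deriv w z)) (at s)"
      by (intro bounded_linear.has_vector_derivative[OF _ D] bounded_linear_Re bounded_linear_Im)+
    then have "DERIV (\<lambda>t. Re (w (p t))) s :> Re (d * deriv w z)" "DERIV (\<lambda>t. Im (w (p t))) s :> Im (d * deriv w z)"
      by (simp_all add: has_real_derivative_iff_has_vector_derivative)
    from DERIV_add[OF DERIV_power[OF this(1), of 2] DERIV_power[OF this(2), of 2]]
    have "DERIV (\<lambda>t. (Re (w (p t)))\<^sup>2 + (Im (w (p t)))\<^sup>2) s :>
        2 * Re (w z) * Re (d * deriv w z) + 2 * Im (w z) * Im (d * deriv w z)"
      by (simp add: p mult_ac)
    then show ?thesis by (simp add: cmod_power2 algebra_simps)
  qed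
  \<comment> \<open>The derivative of |w|^2 along the rotation z cis t at t = 0; it equals -2 Im P
    and vanishes at the maximum.\<close>
  have "2 * Re (cnj (w z) * ((\<i> * z) * deriv w z)) = 0"
  proof (rule DERIV_local_max[OF der[of "\<lambda>t. z * cis t" "\<i> * z" 0]])
    have "((\<lambda>t. z * cis t) has_vector_derivative z * (\<i> * cis 0)) (at 0)"
      by (intro has_vector_derivative_mult_right)
        (auto simp: has_vector_derivative_def intro!: derivative_eq_intros)
    then show "((\<lambda>t. z * cis t) has_vector_derivative \<i> * z) (at 0)" by (simp add: mult.commute)
    show "\<forall>y. \<bar>0 - y\<bar> < 1 \<longrightarrow> (norm (w (z * cis y)))\<^sup>2 \<le> (norm (w (z * cis 0)))\<^sup>2"
      using max by (auto simp: norm_mult intro!: power_mono)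
  qed auto
  then have "Im P = 0" by (simp add: P_def algebra_simps)
  moreover have "(norm (w z))\<^sup>2 \<le> Re P"
  proof (rule ccontr)
    assume less: "\<not> ?thesis"
    obtain h where h: "h holomorphic_on ball 0 R" "\<And>u. norm u < R \<Longrightarrow> w u = u * h u"
      using Schwarz3[OF w w0] by metis
    have sub: "cball 0 (norm z) \<subseteq> ball (0::complex) R" using z by auto
    have hle: "norm (h u) \<le> norm (w z) / norm z" if "u \<in> cball 0 (norm z)" for u
    proof (rule maximum_modulus_frontier[of h "cball 0 (norm z)"])
      show "h holomorphic_on interior (cball 0 (norm z))"
        using h(1) sub by (metis holomorphic_on_subset interior_subset order_trans)
      show "continuous_on (closure (cball 0 (norm z))) h"
        using h(1) sub by (metis closure_closed closed_cball holomorphic_on_imp_continuous_on holomorphic_on_subset)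
      fix v :: complex assume "v \<in> frontier (cball 0 (norm z))"
      then have v: "norm v = norm z" using z0 by auto
      then have "norm (v * h v) \<le> norm (w z)" using max[OF v] h(2)[of v] z by simp
      then show "norm (h v) \<le> norm (w z) / norm z" using v z0 by (simp add: norm_mult field_simps)
    qed (use that in auto)
    \<comment> \<open>The difference t^2 |w z|^2 - |w(t z)|^2 vanishes at t = 1. A positive
      derivative there would make it negative just below 1, against the bound \<open>hle\<close> on
      w(u) / u.\<close>
    have "DERIV (\<lambda>t. t\<^sup>2 * (norm (w z))\<^sup>2 - (norm (w (of_real t * z)))\<^sup>2) 1 :>
        2 * (norm (w z))\<^sup>2 - 2 * Re (cnj (w z) * (z * deriv w z))"
      by (intro DERIV_diff der) (auto intro!: derivative_eq_intros has_vector_derivative_mult_left[of _ 1, simplified])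
    then have "\<exists>d>0. \<forall>e>0. e < d \<longrightarrow> (1 - e)\<^sup>2 * (norm (w z))\<^sup>2 - (norm (w (of_real (1 - e) * z)))\<^sup>2 < 1\<^sup>2 * (norm (w z))\<^sup>2 - (norm (w (of_real 1 * z)))\<^sup>2"
      by (rule DERIV_pos_inc_left) (use less in \<open>simp add: P_def\<close>)
    then obtain d where "d > 0" and d: "\<And>e. 0 < e \<Longrightarrow> e < d \<Longrightarrow>
        (1 - e)\<^sup>2 * (norm (w z))\<^sup>2 < (norm (w (of_real (1 - e) * z)))\<^sup>2" by auto
    define e where "e = min (d / 2) (1 / 2)"
    have e: "0 < e" "e < d" "e < 1" using \<open>d > 0\<close> by (auto simp: e_def)
    let ?u = "of_real (1 - e) * z"
    have nu: "norm ?u = (1 - e) * norm z" using e by (simp add: norm_mult del: of_real_diff)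
    also have "\<dots> \<le> norm z" using e by (simp add: mult_left_le_one_le)
    finally have u: "?u \<in> cball 0 (norm z)" by simp
    have "norm (w ?u) = norm ?u * norm (h ?u)"
      using h(2)[of ?u] u sub by (metis mem_ball_0 norm_mult subsetD)
    also have "\<dots> \<le> ((1 - e) * norm z) * (norm (w z) / norm z)"
      unfolding nu using hle[OF u] e by (intro mult_left_mono) auto
    also have "\<dots> = (1 - e) * norm (w z)" using z0 by simp
    finally have "(norm (w ?u))\<^sup>2 \<le> ((1 - e) * norm (w z))\<^sup>2" by (intro power_mono) auto
    then show False using d[OF e(1,2)] by (simp add: power_mult_distrib)
  qed
  ultimately have P: "P = of_real (Re P)" "(norm (w z))\<^sup>2 \<le> Re P" by (auto simp: complex_eq_iff)
  have n: "0 < (norm (w z))\<^sup>2" using z by simp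
  show ?thesis
  proof
    show "1 \<le> Re P / (norm (w z))\<^sup>2" using P(2) n by simp
    have "of_real ((norm (w z))\<^sup>2) * (z * deriv w z) = w z * P"
      unfolding complex_norm_square P_def by (simp add: mult_ac)
    also have "\<dots> = w z * of_real (Re P)" using P(1) by simp
    finally show "z * deriv w z = of_real (Re P / (norm (w z))\<^sup>2) * w z"
      using n by (simp add: field_simps del: of_real_power)
  qed
qed

text \<open>If \<open>\<omega> = H\<^sup>-\<^sup>1 \<circ> g\<close> violated the Schwarz bound on some circle, then Jack's lemma at the
  maximum of \<open>|\<omega>|\<close> there would put \<open>euler_op b g\<close> on the wrong side of the tangent to the convex
  curve \<open>F_one(|\<zeta>| = r)\<close>.\<close>

lemma subordination_step:
  assumes H: "H holomorphic_on unit_disc" and b: "0 \<le> b"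
    and eu: "\<And>z. z \<in> unit_disc \<Longrightarrow> euler_op b H z = F_one z"
    and w: "w holomorphic_on unit_disc" "w ` unit_disc \<subseteq> unit_disc" "w 0 = 0"
    and gw: "\<And>z. z \<in> unit_disc \<Longrightarrow> euler_op b g z = F_one (w z)"
    and v: "v holomorphic_on ball 0 r" "v ` ball 0 r \<subseteq> unit_disc" "v 0 = 0"
    and gv: "\<And>z. z \<in> ball 0 r \<Longrightarrow> g z = H (v z)"
    and r: "r \<le> 1" and z: "z \<in> ball 0 r"
  shows "norm (v z) \<le> norm z"
proof (rule ccontr)
  assume less: "\<not> ?thesis"
  have "compact (sphere (0::complex) (norm z))" by simp
  moreover have sub: "sphere 0 (norm z) \<subseteq> ball (0::complex) r" using z by auto
  then have "continuous_on (sphere 0 (norm z)) (\<lambda>u. norm (v u))"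
    using v(1) by (intro continuous_intros) (metis holomorphic_on_imp_continuous_on holomorphic_on_subset)
  moreover have "z \<in> sphere 0 (norm z)" by simp
  ultimately obtain y where y: "norm y = norm z" and ymax: "\<And>u. norm u = norm z \<Longrightarrow> norm (v u) \<le> norm (v y)"
    using continuous_attains_sup[of "sphere 0 (norm z)" "\<lambda>u. norm (v u)"]
    by (metis (no_types, lifting) empty_iff mem_sphere_0)
  have yr: "y \<in> ball 0 r" "y \<in> unit_disc" using y z r by auto
  have big: "norm y < norm (v y)" using less ymax[of z] y by auto
  define a where "a = v y"
  have a: "a \<in> unit_disc" "a \<noteq> 0" using v(2) yr big by (auto simp: a_def image_subset_iff)
  obtain m where m: "1 \<le> m" "y * deriv v y = of_real m * a"
    using Jack_lemma[OF v(1,3) yr(1)] ymax y a(2) unfolding a_def by metis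
  have "(v has_field_derivative deriv v y) (at y)" using holomorphic_derivI[OF v(1) _ yr(1)] by simp
  moreover have "(H has_field_derivative deriv H a) (at (v y))"
    using holomorphic_derivI[OF H _ a(1)] by (simp add: a_def)
  ultimately have "((\<lambda>u. H (v u)) has_field_derivative deriv H a * deriv v y) (at y)"
    using DERIV_chain2 by blast
  then have "(g has_field_derivative deriv H a * deriv v y) (at y)"
    by (rule has_field_derivative_transform_within_open[of _ _ _ "ball 0 r"]) (use yr gv in auto)
  then have dg: "deriv g y = deriv H a * deriv v y" by (rule DERIV_imp_deriv)
  have wD: "norm (w u) < 1" if "norm u < 1" for u
    using w(2) that by (metis image_subset_iff mem_ball_0)
  \<comment> \<open>Schwarz for w and the assumed violation |y| < |v y| together put w y at a
    strictly smaller radius than a, so \<open>F_one (w y)\<close> lies strictly inside the tangent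
    at \<open>F_one a\<close>.\<close>
  have "norm (w y) \<le> norm y"
    using yr by (intro Schwarz_Lemma(1)[OF w(1,3) wD]) auto
  then have "norm (w y) < norm a" using big by (simp add: a_def)
  then have u: "w y / a \<in> unit_disc" using a by (simp add: norm_divide)
  define u where "u = w y / a"
  have ua: "u * a = w y" using a by (simp add: u_def)
  have uau: "u * a \<in> unit_disc" unfolding ua using wD yr by simp
  \<comment> \<open>By Jack's lemma the term b y g'(y) equals b m a H'(a), and E H = F_one at a
    absorbs one of the m copies. What remains is a displacement of \<open>F_one a\<close> by b (m -
    1) a H'(a), whose component along the outward normal is nonnegative.\<close>
  have "F_one (w y) = H a + of_real b * (y * deriv v y) * deriv H a"
    using gw[OF yr(2)] gv[OF yr(1)] unfolding euler_op_def dg by (simp add: a_def mult_ac)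
  also have "\<dots> = F_one a + of_real (b * (m - 1)) * a * deriv H a"
    unfolding m(2) using eu[OF a(1)] by (simp add: euler_op_def algebra_simps)
  finally have "F_one a - F_one (u * a) = - (of_real (b * (m - 1)) * a * deriv H a)"
    unfolding ua by simp
  then have "(F_one a - F_one (u * a)) * (1 - a)\<^sup>2 = a * - (of_real (b * (m - 1)) * (deriv H a * (1 - a)\<^sup>2))"
    by (simp add: mult_ac)
  then have "2 * ((1 - u) * (1 - a) / (1 - u * a)) = - (of_real (b * (m - 1)) * (deriv H a * (1 - a)\<^sup>2))"
    unfolding F_one_diff[OF a(1) uau] using a(2) by (simp only: mult.assoc mult.left_commute[of 2 a] mult_cancel_left simp_thms)
  then have "2 * Re ((1 - u) * (1 - a) / (1 - u * a)) = - (b * (m - 1)) * Re (deriv H a * (1 - a)\<^sup>2)"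
    by (drule_tac arg_cong[of _ _ Re]) (simp only: Re_numeral_mult uminus_complex.sel Re_of_real_mult mult_minus_left)
  moreover have "0 \<le> b * (m - 1) * Re (deriv H a * (1 - a)\<^sup>2)"
    using Re_deriv_euler_solution_pos[OF H b eu a(1)] b m by simp
  ultimately show False
    using Re_F_one_mean_pos[OF _ a(1), of u] u unfolding u_def[symmetric] by simp
qed

text \<open>\<open>subordination_step\<close> controls H^-1 o g only on discs where this composition
  is defined. The substance here is that g never leaves the image of H.\<close>

lemma subordination:
  assumes H: "H holomorphic_on unit_disc" and b: "0 \<le> b"
    and eu: "\<And>z. z \<in> unit_disc \<Longrightarrow> euler_op b H z = F_one z"
    and g: "g holomorphic_on unit_disc" "g 0 = 1"
    and pos: "\<And>z. z \<in> unit_disc \<Longrightarrow> 0 < Re (euler_op b g z)"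
  obtains v where "v holomorphic_on unit_disc" "v ` unit_disc \<subseteq> unit_disc" "v 0 = 0"
    "\<And>z. z \<in> unit_disc \<Longrightarrow> g z = H (v z)"
proof -
  \<comment> \<open>This is F_one^-1 o E g, so positivity of Re (E g) becomes E g = F_one o w with w
    a Schwarz function.\<close>
  define w where "w z = (euler_op b g z - 1) / (euler_op b g z + 1)" for z
  have w: "w holomorphic_on unit_disc" "w ` unit_disc \<subseteq> unit_disc" "w 0 = 0"
      "\<And>z. z \<in> unit_disc \<Longrightarrow> euler_op b g z = F_one (w z)"
  proof -
    show "w holomorphic_on unit_disc"
      unfolding w_def[abs_def] using F_one_inverse(3)[OF pos]
      by (intro holomorphic_intros euler_op_holomorphic g) auto
  qed (use F_one_inverse[OF pos] g in \<open>auto simp: w_def euler_op_def\<close>)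
  have H0: "H 0 = 1" using eu[of 0] by (simp add: euler_op_def F_one_def)
  have inj: "inj_on H unit_disc" by (rule euler_solution_inj_on[OF H b eu])
  obtain h where h: "h holomorphic_on H ` unit_disc" "\<And>z. z \<in> unit_disc \<Longrightarrow> h (H z) = z"
    using holomorphic_has_inverse[OF H open_ball inj] by metis
  have U: "open (H ` unit_disc)" by (rule open_mapping_thm3[OF H open_ball inj])
  have comp: "(\<lambda>z. h (g z)) holomorphic_on ball 0 r" "(\<lambda>z. h (g z)) ` ball 0 r \<subseteq> unit_disc" "h (g 0) = 0"
    "\<And>z. z \<in> ball 0 r \<Longrightarrow> g z = H (h (g z))"
    if r: "r \<le> 1" "g ` ball 0 r \<subseteq> H ` unit_disc" for r
  proof -
    have "g holomorphic_on ball 0 r" by (rule holomorphic_on_subset[OF g(1)]) (use r in auto)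
    then have "h \<circ> g holomorphic_on ball 0 r" by (rule holomorphic_on_compose_gen[OF _ h(1) r(2)])
    then show "(\<lambda>z. h (g z)) holomorphic_on ball 0 r" by (simp add: o_def)
    show "(\<lambda>z. h (g z)) ` ball 0 r \<subseteq> unit_disc" using r(2) h(2) by (force simp: image_subset_iff)
    show "h (g 0) = 0" using h(2)[of 0] H0 g(2) by simp
    show "g z = H (h (g z))" if "z \<in> ball 0 r" for z using r(2) h(2) that by (force simp: image_subset_iff)
  qed
  have range: "g ` unit_disc \<subseteq> H ` unit_disc"
  proof (rule ccontr)
    assume "\<not> ?thesis"
    then obtain y where y: "y \<in> unit_disc" "g y \<notin> H ` unit_disc" unfolding image_subset_iff by blast
    \<comment> \<open>C collects the points of a closed disc where g escapes from the open set H(D).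
      It is compact, so it has a point x of least norm, and H^-1 o g exists on the open disc of
      radius |x|.\<close>
    define C where "C = cball 0 (norm y) \<inter> g -` (- (H ` unit_disc))"
    have "continuous_on (cball 0 (norm y)) g"
      using y g(1) by (intro holomorphic_on_imp_continuous_on holomorphic_on_subset[OF g(1)]) auto
    then have "closed C"
      unfolding C_def using U by (intro continuous_closed_preimage) (auto simp: closed_Compl)
    then have "compact C" unfolding C_def by (metis compact_Int_closed compact_cball inf.left_idem)
    moreover have "y \<in> C" using y by (simp add: C_def)
    ultimately obtain x where x: "x \<in> C" "\<And>u. u \<in> C \<Longrightarrow> norm x \<le> norm u"
      using continuous_attains_inf[of C norm] continuous_on_norm_id by blast
    define r where "r = norm x"
    have r1: "r < 1" using x(1) y by (auto simp: r_def C_def)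
    have rsub: "g ` ball 0 r \<subseteq> H ` unit_disc"
    proof clarify
      fix u :: complex assume u: "u \<in> ball 0 r"
      then have "u \<notin> C" using x(2)[of u] by (auto simp: r_def)
      then show "g u \<in> H ` unit_disc" using u x(1) by (auto simp: C_def r_def)
    qed
    have "x \<noteq> 0" using x(1) g(2) H0 by (force simp: C_def)
    then have "0 < r" by (simp add: r_def)
    have "h (g u) \<in> cball 0 r" if "u \<in> ball 0 r" for u
      using subordination_step[OF H b eu w(1-4) comp(1-4)[OF _ rsub] _ that] r1 that by simp
    then have "g u \<in> H ` cball 0 r" if "u \<in> ball 0 r" for u
      using comp(4)[OF _ rsub that] r1 that by (metis image_eqI less_imp_le)
    \<comment> \<open>The Schwarz bound keeps the values in the image of the closed disc of radius r
      < 1. That image is compact, so the inclusion extends to the boundary point x, which was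
      supposed to escape.\<close>
    then have "g ` ball 0 r \<subseteq> H ` cball 0 r" by auto
    moreover have "compact (H ` cball 0 r)"
      using r1 by (intro compact_continuous_image holomorphic_on_imp_continuous_on holomorphic_on_subset[OF H]) auto
    moreover have "continuous_on (closure (ball 0 r)) g"
      using r1 \<open>0 < r\<close> by (intro holomorphic_on_imp_continuous_on holomorphic_on_subset[OF g(1)]) auto
    ultimately have "g ` closure (ball 0 r) \<subseteq> H ` cball 0 r"
      by (intro image_closure_subset compact_imp_closed)
    then have "g x \<in> H ` cball 0 r" using \<open>0 < r\<close> by (auto simp: r_def)
    then show False using x(1) r1 by (auto simp: C_def)
  qed
  show ?thesis by (rule that[of "\<lambda>z. h (g z)"]) (use comp[OF order_refl range] in simp_all)
qed

section \<open>The Herglotz representation\<close>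

abbreviation (input) unit_circle :: "complex set" where
  "unit_circle \<equiv> sphere 0 1"

abbreviation (input) circle_borel :: "complex measure" where
  "circle_borel \<equiv> restrict_space borel unit_circle"

definition circle_transform :: "complex measure \<Rightarrow> (complex \<Rightarrow> complex) \<Rightarrow> complex \<Rightarrow> complex" where
  "circle_transform \<mu> g z = (\<integral>\<zeta>. g (z * cnj \<zeta>) \<partial>\<mu>)"

lemma space_circle_measure:
  "sets \<mu> = sets circle_borel \<Longrightarrow> space \<mu> = unit_circle"
  by (drule sets_eq_imp_space_eq) (simp add: space_restrict_space)

lemma circle_integrable:
  fixes g :: "complex \<Rightarrow> complex"
  assumes "prob_space \<mu>" and \<mu>: "sets \<mu> = sets circle_borel" and g: "continuous_on unit_circle g"
  shows "integrable \<mu> g"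
proof -
  interpret prob_space \<mu> by fact
  have "g \<in> borel_measurable \<mu>"
    using borel_measurable_continuous_on_restrict[OF g] measurable_cong_sets[OF \<mu> refl] by blast
  moreover obtain B where "\<And>\<zeta>. \<zeta> \<in> unit_circle \<Longrightarrow> norm (g \<zeta>) \<le> B"
    using compact_continuous_image[OF g compact_sphere] by (meson bounded_iff compact_imp_bounded imageI)
  ultimately show ?thesis
    using space_circle_measure[OF \<mu>] by (intro integrable_const_bound[of _ B]) auto
qed

text \<open>Since |cnj \<zeta>| = 1 on the circle, the series is dominated by its absolute values at
  z and may be integrated term by term. Averaging thus acts on coefficients by the moments of the
  measure.\<close>

lemma circle_transform_sums:
  assumes "prob_space \<mu>" and \<mu>: "sets \<mu> = sets circle_borel"
    and a: "\<And>z. z \<in> unit_disc \<Longrightarrow> (\<lambda>n. a n * z ^ n) sums g z" and z: "z \<in> unit_disc"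
  shows "(\<lambda>n. a n * (\<integral>\<zeta>. cnj \<zeta> ^ n \<partial>\<mu>) * z ^ n) sums circle_transform \<mu> g z"
proof -
  interpret prob_space \<mu> by fact
  note sp = space_circle_measure[OF \<mu>]
  let ?f = "\<lambda>n \<zeta>. a n * z ^ n * cnj \<zeta> ^ n"
  have norm: "norm (?f n \<zeta>) = norm (a n * z ^ n)" if "\<zeta> \<in> space \<mu>" for n \<zeta>
    using that by (simp add: sp norm_mult norm_power)
  have sm: "summable (\<lambda>n. norm (a n * z ^ n))" by (rule coeffs_abs_summable[OF a z])
  have int: "(\<integral>\<zeta>. norm (?f n \<zeta>) \<partial>\<mu>) = norm (a n * z ^ n)" for n
    by (subst Bochner_Integration.integral_cong[OF refl norm]) (simp_all add: prob_space)
  have "(\<lambda>n. \<integral>\<zeta>. ?f n \<zeta> \<partial>\<mu>) sums (\<integral>\<zeta>. (\<Sum>n. ?f n \<zeta>) \<partial>\<mu>)"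
  proof (rule sums_integral)
    show "integrable \<mu> (?f n)" for n
      by (rule circle_integrable[OF assms(1) \<mu>]) (intro continuous_intros)
    show "AE \<zeta> in \<mu>. summable (\<lambda>n. norm (?f n \<zeta>))"
    proof (rule AE_I2)
      fix \<zeta> assume "\<zeta> \<in> space \<mu>"
      then show "summable (\<lambda>n. norm (?f n \<zeta>))" using sm by (simp only: norm)
    qed
    show "summable (\<lambda>n. \<integral>\<zeta>. norm (?f n \<zeta>) \<partial>\<mu>)" using sm by (simp only: int)
  qed
  moreover have "(\<integral>\<zeta>. (\<Sum>n. ?f n \<zeta>) \<partial>\<mu>) = circle_transform \<mu> g z"
    unfolding circle_transform_def
  proof (rule Bochner_Integration.integral_cong[OF refl])
    fix \<zeta> assume "\<zeta> \<in> space \<mu>"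
    then have "z * cnj \<zeta> \<in> unit_disc" using z by (simp add: sp norm_mult)
    from sums_unique[OF a[OF this]] show "(\<Sum>n. ?f n \<zeta>) = g (z * cnj \<zeta>)"
      by (simp add: power_mult_distrib mult_ac)
  qed
  ultimately show ?thesis by (simp add: mult_ac)
qed

section \<open>Fourier moments on circles of radius below 1\<close>

text \<open>Normalised arc length, kept as a measure of angles on the real line so that tightness
  and weak convergence of real distributions apply.\<close>

definition uniform_angle :: "real measure" where
  "uniform_angle = density lborel (\<lambda>t. ennreal (indicator {0..2*pi} t / (2 * pi)))"

lemma sets_uniform_angle [simp, measurable_cong]: "sets uniform_angle = sets borel"
  by (simp add: uniform_angle_def)

lemma space_uniform_angle [simp]: "space uniform_angle = UNIV"
  by (simp add: uniform_angle_def)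

lemma integral_uniform_angle_cis:
  "(\<integral>t. cis (of_int k * t) \<partial>uniform_angle) = (if k = 0 then 1 else 0)"
proof -
  have "(\<integral>t. cis (of_int k * t) \<partial>uniform_angle) =
      (\<integral>t. (indicator {0..2*pi} t / (2 * pi)) *\<^sub>R cis (of_int k * t) \<partial>lborel)"
    unfolding uniform_angle_def
    by (intro integral_density) (auto intro!: borel_measurable_continuous_onI continuous_intros)
  also have "\<dots> = (\<integral>t. indicator {0..2*pi} t *\<^sub>R (cis (of_int k * t) / of_real (2 * pi)) \<partial>lborel)"
    by (simp add: scaleR_conv_of_real field_simps)
  also have "\<dots> = (if k = 0 then 1 else 0)"
  proof (cases "k = 0")
    case True
    then show ?thesis by (subst integral_FTC_atLeastAtMost[where F="\<lambda>t. of_real t / of_real (2 * pi)"])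
        (auto intro!: derivative_eq_intros continuous_intros has_vector_derivative_divide)
  next
    case False
    let ?F = "\<lambda>t. cis (of_int k * t) * (1 / (\<i> * of_int k * of_real (2 * pi)))"
    have "(?F has_vector_derivative cis (of_int k * t) / of_real (2 * pi)) (at t within A)" for t A
    proof -
      have "((\<lambda>t. cis (of_int k * t)) has_vector_derivative of_int k * (\<i> * cis (of_int k * t))) (at t within A)"
        unfolding has_vector_derivative_def
        by (auto intro!: derivative_eq_intros simp: fun_eq_iff scaleR_conv_of_real mult_ac)
      from has_vector_derivative_mult_left[OF this, of "1 / (\<i> * of_int k * of_real (2 * pi))"]
      show ?thesis using False by (simp add: field_simps)
    qed
    then have "(\<integral>t. indicator {0..2*pi} t *\<^sub>R (cis (of_int k * t) / of_real (2 * pi)) \<partial>lborel) = ?F (2 * pi) - ?F 0"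
      by (intro integral_FTC_atLeastAtMost) (auto intro!: continuous_intros)
    moreover have "cis (of_int k * (2 * pi)) = 1"
      using cis_multiple_2pi[of "of_int k"] by (simp add: mult_ac)
    ultimately show ?thesis using False by simp
  qed
  finally show ?thesis .
qed

lemma measurable_cis: "(\<lambda>t. cis (c * t)) \<in> borel_measurable uniform_angle"
  using borel_measurable_continuous_onI[of "\<lambda>t. cis (c * t)"]
    measurable_cong_sets[OF sets_uniform_angle refl] continuous_on_cis[of UNIV "\<lambda>t. c * t"]
  by (auto intro!: continuous_intros)

lemma prob_space_uniform_angle: "prob_space uniform_angle"
proof
  have i: "integrable lborel (\<lambda>t. indicator {0..2*pi} t / (2 * pi) :: real)" by simp
  have "emeasure uniform_angle (space uniform_angle) = (\<integral>\<^sup>+t. ennreal (indicator {0..2*pi} t / (2 * pi)) \<partial>lborel)"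
    unfolding uniform_angle_def by (subst emeasure_density) auto
  also have "\<dots> = ennreal (\<integral>t. indicator {0..2*pi} t / (2 * pi) \<partial>lborel)"
    by (rule nn_integral_eq_integral[OF i]) auto
  also have "\<dots> = 1" by simp
  finally show "emeasure uniform_angle (space uniform_angle) = 1" .
qed

interpretation uniform_angle: prob_space uniform_angle by (rule prob_space_uniform_angle)

text \<open>By orthogonality only the term of index -k survives; for k > 0 there is none, since q
  has no negative powers. Absolute convergence at radius r < 1 justifies termwise
  integration.\<close>

lemma uniform_angle_moment:
  fixes k :: int
  assumes a: "\<And>z. z \<in> unit_disc \<Longrightarrow> (\<lambda>n. a n * z ^ n) sums q z" and r: "0 \<le> r" "r < 1"
  shows "integrable uniform_angle (\<lambda>t. q (of_real r * cis t) * cis (of_int k * t))"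
    and "(\<integral>t. q (of_real r * cis t) * cis (of_int k * t) \<partial>uniform_angle) =
      (if k \<le> 0 then a (nat (- k)) * of_real r ^ nat (- k) else 0)"
proof -
  let ?f = "\<lambda>m t. a m * of_real r ^ m * cis (of_int (int m + k) * t)"
  have n: "norm (?f m t) = norm (a m * of_real r ^ m)" for m t by (simp add: norm_mult)
  have "complex_of_real r \<in> unit_disc" using r by simp
  then have sm: "summable (\<lambda>m. norm (a m * of_real r ^ m))" using coeffs_abs_summable[of a q, OF a] by blast
  have i: "integrable uniform_angle (?f m)" for m
    by (rule uniform_angle.integrable_const_bound[of _ "norm (a m * of_real r ^ m)"])
       (simp_all only: n order_refl eventually_True borel_measurable_times borel_measurable_const measurable_cis)
  have s1: "AE t in uniform_angle. summable (\<lambda>m. norm (?f m t))" by (rule AE_I2) (use sm in \<open>simp only: n\<close>)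
  have s2: "summable (\<lambda>m. \<integral>t. norm (?f m t) \<partial>uniform_angle)"
    using sm unfolding n by (simp add: uniform_angle.prob_space)
  have eq: "(\<Sum>m. ?f m t) = q (of_real r * cis t) * cis (of_int k * t)" for t
  proof -
    have "of_real r * cis t \<in> unit_disc" using r by (simp add: norm_mult)
    from sums_mult2[OF a[OF this], of "cis (of_int k * t)"]
    moreover have cis: "cis t ^ m * cis (of_int k * t) = cis (of_int (int m + k) * t)" for m :: nat
      unfolding Complex.DeMoivre cis_mult by (simp add: distrib_right)
    have "a m * (of_real r * cis t) ^ m * cis (of_int k * t) = ?f m t" for m
      by (simp only: power_mult_distrib mult.assoc cis)
    ultimately show ?thesis by (simp add: sums_iff)
  qed
  show "integrable uniform_angle (\<lambda>t. q (of_real r * cis t) * cis (of_int k * t))"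
    using integrable_suminf[OF i s1 s2] unfolding eq .
  have "(\<lambda>m. \<integral>t. ?f m t \<partial>uniform_angle) sums (\<integral>t. q (of_real r * cis t) * cis (of_int k * t) \<partial>uniform_angle)"
    using sums_integral[OF i s1 s2] unfolding eq .
  moreover have "(\<integral>t. ?f m t \<partial>uniform_angle) = (if int m = - k then a m * of_real r ^ m else 0)" for m
    using integral_uniform_angle_cis[of "int m + k"] by auto
  moreover have "(\<lambda>m. if int m = - k then a m * of_real r ^ m else 0) sums
     (if k \<le> 0 then a (nat (- k)) * of_real r ^ nat (- k) else 0)"
  proof (cases "k \<le> 0")
    case True
    then have "int m = - k \<longleftrightarrow> m = nat (- k)" for m by auto
    then show ?thesis using True sums_single[of "nat (- k)" "\<lambda>m. a m * of_real r ^ m"] by simp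
  next
    case False
    then have "int m \<noteq> - k" for m by simp
    then show ?thesis using False by simp
  qed
  ultimately show "(\<integral>t. q (of_real r * cis t) * cis (of_int k * t) \<partial>uniform_angle) =
      (if k \<le> 0 then a (nat (- k)) * of_real r ^ nat (- k) else 0)"
    by (simp add: sums_unique2)
qed

text \<open>For q = \<open>F_one\<close> the density is the Poisson kernel. The weak limit of these
  measures as r tends to 1 yields the Herglotz measure.\<close>

definition poisson_measure :: "(complex \<Rightarrow> complex) \<Rightarrow> real \<Rightarrow> real measure" where
  "poisson_measure q r = density uniform_angle (\<lambda>t. ennreal (Re (q (of_real r * cis t))))"

lemma measurable_Re_circle:
  assumes q: "q holomorphic_on unit_disc" and r: "0 \<le> r" "r < 1"
  shows "(\<lambda>t. Re (q (of_real r * cis t))) \<in> borel_measurable uniform_angle"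
proof -
  have "of_real r * cis t \<in> unit_disc" for t using r by (simp add: norm_mult)
  then have "continuous_on UNIV (\<lambda>t. Re (q (of_real r * cis t)))"
    by (intro continuous_intros continuous_on_compose2[OF holomorphic_on_imp_continuous_on[OF q]]) auto
  then show ?thesis
    using borel_measurable_continuous_onI measurable_cong_sets[OF sets_uniform_angle refl] by blast
qed

text \<open>Write Re Q = (Q + cnj Q) / 2. The first summand contributes a_n r^n, the second only at
  n = 0, hence the factor 1/2 for n > 0. The total mass 1 is the moment n = 0, where a_0 = q 0 =
  1.\<close>

lemma poisson_measure_moment:
  assumes q: "q holomorphic_on unit_disc" "q 0 = 1" and pos: "\<And>z. z \<in> unit_disc \<Longrightarrow> 0 < Re (q z)"
    and r: "0 \<le> r" "r < 1"
  shows "prob_space (poisson_measure q r)"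
    and "(\<integral>t. cis (- (real n * t)) \<partial>poisson_measure q r) =
      (if n = 0 then 1 else fps_nth (fps_expansion q 0) n * of_real r ^ n / 2)"
proof -
  define a where "a = fps_nth (fps_expansion q 0)"
  have a: "(\<lambda>n. a n * z ^ n) sums q z" if "z \<in> unit_disc" for z
    unfolding a_def by (rule coeffs_sums[OF q(1) that])
  have a0: "a 0 = 1" using a[of 0] q(2) sums_unique[of "\<lambda>n. a n * 0 ^ n"] by (simp add: sums_iff powser_zero)
  have disc: "of_real r * cis t \<in> unit_disc" for t using r by (simp add: norm_mult)
  define Q where "Q t = q (of_real r * cis t)" for t
  have mQ: "(\<lambda>t. Re (Q t)) \<in> borel_measurable uniform_angle"
    unfolding Q_def by (rule measurable_Re_circle[OF q(1) r])
  have pQ: "0 \<le> Re (Q t)" for t using pos[OF disc] by (simp add: Q_def less_imp_le)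
  have sym: "cnj (cis x) = cis (- x)" for x by (simp add: cis_cnj)
  have m: "(\<integral>t. Re (Q t) *\<^sub>R cis (- (real n * t)) \<partial>uniform_angle) =
      (if n = 0 then 1 else a n * of_real r ^ n / 2)" for n
  proof -
    note mom = uniform_angle_moment[OF a r, folded Q_def]
    have i1: "integrable uniform_angle (\<lambda>t. Q t * cis (- (real n * t)))"
      using mom(1)[of "- int n"] by simp
    have "integrable uniform_angle (\<lambda>t. cnj (Q t * cis (real n * t)))"
      using mom(1)[of "int n"] by (intro integrable_cnj) simp
    then have i2: "integrable uniform_angle (\<lambda>t. cnj (Q t) * cis (- (real n * t)))"
      by (simp add: cis_cnj)
    have "(\<integral>t. Re (Q t) *\<^sub>R cis (- (real n * t)) \<partial>uniform_angle) =
       (\<integral>t. (Q t * cis (- (real n * t)) + cnj (Q t) * cis (- (real n * t))) / 2 \<partial>uniform_angle)"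
      by (intro Bochner_Integration.integral_cong refl)
         (simp add: complex_eq_iff scaleR_conv_of_real field_simps)
    also have "\<dots> = ((\<integral>t. Q t * cis (- (real n * t)) \<partial>uniform_angle) +
        (\<integral>t. cnj (Q t) * cis (- (real n * t)) \<partial>uniform_angle)) / 2"
      using i1 i2 by simp
    also have "(\<integral>t. Q t * cis (- (real n * t)) \<partial>uniform_angle) = a n * of_real r ^ n"
      using mom(2)[of "- int n"] by simp
    also have "(\<integral>t. cnj (Q t) * cis (- (real n * t)) \<partial>uniform_angle) =
        cnj (\<integral>t. Q t * cis (real n * t) \<partial>uniform_angle)"
      by (subst Bochner_Integration.integral_cnj[symmetric]) (simp add: cis_cnj)
    also have "\<dots> = (if n = 0 then 1 else 0)"
      using mom(2)[of "int n"] a0 by simp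
    finally show ?thesis using a0 by (cases "n = 0") simp_all
  qed
  have "integrable uniform_angle (\<lambda>t. Re (Q t))"
    using uniform_angle_moment(1)[OF a r, of 0, folded Q_def] by simp
  moreover from this have "(\<integral>t. Re (Q t) \<partial>uniform_angle) = 1"
    using m[of 0] by (simp add: scaleR_conv_of_real)
  ultimately have "(\<integral>\<^sup>+t. ennreal (Re (Q t)) \<partial>uniform_angle) = 1"
    using pQ by (subst nn_integral_eq_integral) auto
  then show "prob_space (poisson_measure q r)"
    using mQ unfolding poisson_measure_def Q_def[symmetric]
    by (intro prob_spaceI) (simp add: emeasure_density)
  show "(\<integral>t. cis (- (real n * t)) \<partial>poisson_measure q r) =
      (if n = 0 then 1 else fps_nth (fps_expansion q 0) n * of_real r ^ n / 2)"
    unfolding a_def[symmetric] m[symmetric] poisson_measure_def Q_def[symmetric]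
    by (intro integral_density mQ) (use pQ measurable_cis[of "- real n"] in simp_all)
qed

text \<open>Tightness is phrased with half-open intervals; this one contains [0, 2 pi] because pi <
  4, and it serves all r at once.\<close>

lemma poisson_measure_interval:
  assumes q: "q holomorphic_on unit_disc" and r: "0 \<le> r" "r < 1" and "prob_space (poisson_measure q r)"
  shows "measure (poisson_measure q r) {-1<..8} = 1"
proof -
  interpret prob_space "poisson_measure q r" by fact
  have "AE t in lborel. 0 < ennreal (indicator {0..2*pi} t / (2 * pi)) \<longrightarrow> t \<in> {-1<..8}"
    using pi_less_4 by (intro AE_I2) (auto simp: indicator_def split: if_splits)
  then have "AE t in uniform_angle. t \<in> {-1<..8}"
    unfolding uniform_angle_def by (subst AE_density) auto
  then have "AE t in poisson_measure q r. t \<in> {-1<..8}"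
    unfolding poisson_measure_def using measurable_Re_circle[OF q r]
    by (subst AE_density) auto
  then show ?thesis by (subst AE_in_set_eq_1[symmetric]) (auto simp: poisson_measure_def)
qed

lemma F_one_sums:
  assumes "z \<in> unit_disc"
  shows "(\<lambda>n. (if n = 0 then 1 else 2) * z ^ n) sums F_one z"
proof -
  have "(\<lambda>n. 2 * z ^ n - (if n = 0 then 1 else 0)) sums (2 * (1 / (1 - z)) - 1)"
    using assms by (intro sums_diff sums_mult geometric_sums sums_single[of 0 "\<lambda>_. 1", simplified]) auto
  moreover have "2 * (1 / (1 - z)) - 1 = F_one z"
    using assms by (auto simp: F_one_def divide_simps)
  moreover have "2 * z ^ n - (if n = 0 then 1 else 0) = (if n = 0 then 1 else 2) * z ^ n" for n by simp
  ultimately show ?thesis by simp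
qed

theorem Herglotz:
  assumes q: "q holomorphic_on unit_disc" "q 0 = 1" and pos: "\<And>z. z \<in> unit_disc \<Longrightarrow> 0 < Re (q z)"
  obtains \<mu> where "prob_space \<mu>" "sets \<mu> = sets circle_borel"
    "\<And>z. z \<in> unit_disc \<Longrightarrow> circle_transform \<mu> F_one z = q z"
proof -
  define a where "a = fps_nth (fps_expansion q 0)"
  have a: "(\<lambda>n. a n * z ^ n) sums q z" if "z \<in> unit_disc" for z
    unfolding a_def by (rule coeffs_sums[OF q(1) that])
  define r where "r j = real j / real (Suc j)" for j
  have r: "0 \<le> r j" "r j < 1" for j by (auto simp: r_def)
  have r_lim: "r \<longlonglongrightarrow> 1" unfolding r_def[abs_def] by (rule LIMSEQ_n_over_Suc_n)
  define M where "M j = poisson_measure q (r j)" for j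
  have prob: "prob_space (M j)" for j
    unfolding M_def by (rule poisson_measure_moment(1)[OF q pos r])
  have rd: "real_distribution (M j)" for j
    by (intro real_distribution.intro real_distribution_axioms.intro prob) (simp add: M_def poisson_measure_def)
  have "tight M"
    unfolding tight_def
  proof (intro conjI allI impI rd)
    fix \<epsilon> :: real assume "0 < \<epsilon>"
    then show "\<exists>a b. a < b \<and> (\<forall>n. 1 - \<epsilon> < measure (M n) {a<..b})"
      using poisson_measure_interval[OF q(1) r prob[unfolded M_def]]
      by (intro exI[of _ "-1"] exI[of _ 8]) (simp add: M_def)
  qed
  \<comment> \<open>Convergence along a subsequence suffices: the moments converge as the radii tend
    to 1, which determines the moments of L.\<close>
  from tight_imp_convergent_subsubsequence[OF this strict_mono_id] obtain s L where
    s: "strict_mono s" and L: "real_distribution L" and conv: "weak_conv_m (M \<circ> id \<circ> s) L" by blast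
  have rd': "real_distribution ((M \<circ> id \<circ> s) n)" for n using rd by simp
  have mom: "(\<integral>t. cis (- (real n * t)) \<partial>L) = (if n = 0 then 1 else a n / 2)" for n
  proof (rule LIMSEQ_unique)
    have cont: "continuous_on UNIV (\<lambda>t. cis (- (real n * t)))" by (intro continuous_intros)
    show "(\<lambda>j. \<integral>t. cis (- (real n * t)) \<partial>(M \<circ> id \<circ> s) j) \<longlonglongrightarrow> (\<integral>t. cis (- (real n * t)) \<partial>L)"
      by (rule weak_conv_imp_integral_bdd_continuous_conv[OF rd' L conv, where B=1])
         (use cont continuous_on_eq_continuous_at[OF open_UNIV] in auto)
    have "(\<lambda>j. r (s j)) \<longlonglongrightarrow> 1" using LIMSEQ_subseq_LIMSEQ[OF r_lim s] by (simp add: o_def)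
    then have lim: "(\<lambda>j. complex_of_real (r (s j))) \<longlonglongrightarrow> 1"
      using tendsto_of_real by fastforce
    have "(\<lambda>j. a n * of_real (r (s j)) ^ n / 2) \<longlonglongrightarrow> a n * 1 ^ n / 2"
      by (intro tendsto_intros lim) auto
    then have "(\<lambda>j. if n = 0 then 1 else a n * of_real (r (s j)) ^ n / 2) \<longlonglongrightarrow>
        (if n = 0 then 1 else a n / 2)"
      by (cases "n = 0") simp_all
    then show "(\<lambda>j. \<integral>t. cis (- (real n * t)) \<partial>(M \<circ> id \<circ> s) j) \<longlonglongrightarrow> (if n = 0 then 1 else a n / 2)"
      by (simp only: o_apply id_apply M_def poisson_measure_moment(2)[OF q pos r] a_def[symmetric])
  qed
  interpret L: real_distribution L by fact
  \<comment> \<open>Only integrals of powers of \<open>cis\<close> matter, and these are preserved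
    when the angle distribution is pushed forward to the circle.\<close>
  define \<mu> where "\<mu> = distr L circle_borel cis"
  have cis: "cis \<in> measurable L circle_borel"
  proof (rule measurable_restrict_space2)
    have "cis \<in> borel_measurable borel"
      by (intro borel_measurable_continuous_onI) (auto intro!: continuous_intros)
    then show "cis \<in> borel_measurable L" by simp
  qed auto
  have \<mu>: "prob_space \<mu>" "sets \<mu> = sets circle_borel"
    unfolding \<mu>_def using L.prob_space_distr[OF cis] by simp_all
  have c: "(\<integral>\<zeta>. cnj \<zeta> ^ n \<partial>\<mu>) = (if n = 0 then 1 else a n / 2)" for n
  proof -
    have "(\<lambda>\<zeta>. cnj \<zeta> ^ n) \<in> borel_measurable circle_borel"
      by (intro borel_measurable_continuous_on_restrict continuous_intros)
    then have "(\<integral>\<zeta>. cnj \<zeta> ^ n \<partial>\<mu>) = (\<integral>t. cnj (cis t) ^ n \<partial>L)"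
      unfolding \<mu>_def by (rule integral_distr[OF cis])
    then show ?thesis using mom[of n] by (simp add: cis_cnj Complex.DeMoivre)
  qed
  have a0: "a 0 = 1" using a[of 0] q(2) by (simp add: sums_iff powser_zero)
  show ?thesis
  proof (rule that[OF \<mu>])
    fix z assume z: "z \<in> unit_disc"
    \<comment> \<open>The coefficients 2 of \<open>F_one\<close> undo the halving caused by taking
      real parts.\<close>
    have "(if n = 0 then 1 else 2) * (\<integral>\<zeta>. cnj \<zeta> ^ n \<partial>\<mu>) = a n" for n
      using a0 by (simp add: c)
    with circle_transform_sums[OF \<mu> F_one_sums z]
    have "(\<lambda>n. a n * z ^ n) sums circle_transform \<mu> F_one z" by simp
    then show "circle_transform \<mu> F_one z = q z" using a[OF z] sums_unique2 by blast
  qed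
qed

lemma circle_transform_holomorphic:
  assumes \<mu>: "prob_space \<mu>" "sets \<mu> = sets circle_borel" and g: "g holomorphic_on unit_disc"
  shows "circle_transform \<mu> g holomorphic_on unit_disc"
  by (rule power_series_holomorphic_on[OF circle_transform_sums[OF \<mu> coeffs_sums[OF g]]])

text \<open>Both operations multiply the n-th coefficient, one by \<open>1 + b n\<close>, the other
  by a moment, so they commute.\<close>

lemma euler_op_circle_transform:
  assumes \<mu>: "prob_space \<mu>" "sets \<mu> = sets circle_borel" and g: "g holomorphic_on unit_disc"
    and z: "z \<in> unit_disc"
  shows "euler_op b (circle_transform \<mu> g) z = circle_transform \<mu> (euler_op b g) z"
proof -
  note * = euler_op_sums[OF coeffs_sums[OF g], of _ b]
  from euler_op_sums[OF circle_transform_sums[OF \<mu> coeffs_sums[OF g]] z, of b]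
    circle_transform_sums[OF \<mu> * z]
  show ?thesis by (simp only: mult.assoc sums_iff)
qed

lemma circle_transform_affine:
  assumes \<mu>: "prob_space \<mu>" "sets \<mu> = sets circle_borel" and g: "g holomorphic_on unit_disc"
    and z: "z \<in> unit_disc"
  shows "circle_transform \<mu> (\<lambda>w. c * g w + d) z = c * circle_transform \<mu> g z + d"
proof -
  interpret prob_space \<mu> by (rule \<mu>(1))
  have "integrable \<mu> (\<lambda>\<zeta>. g (z * cnj \<zeta>))"
    using z by (intro circle_integrable[OF \<mu>] continuous_intros
       continuous_on_compose2[OF holomorphic_on_imp_continuous_on[OF g]]) (auto simp: norm_mult)
  then show ?thesis by (simp add: circle_transform_def prob_space)
qed

lemma Re_circle_transform_ge:
  assumes \<mu>: "prob_space \<mu>" "sets \<mu> = sets circle_borel" and g: "g holomorphic_on unit_disc"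
    and z: "z \<in> unit_disc" and ge: "\<And>w. w \<in> unit_disc \<Longrightarrow> c \<le> Re (g w)"
  shows "c \<le> Re (circle_transform \<mu> g z)"
proof -
  interpret prob_space \<mu> by (rule \<mu>(1))
  have disc: "z * cnj \<zeta> \<in> unit_disc" if "\<zeta> \<in> space \<mu>" for \<zeta>
    using z that by (simp add: norm_mult space_circle_measure[OF \<mu>(2)])
  have i: "integrable \<mu> (\<lambda>\<zeta>. g (z * cnj \<zeta>))"
    using z by (intro circle_integrable[OF \<mu>] continuous_intros
       continuous_on_compose2[OF holomorphic_on_imp_continuous_on[OF g]]) (auto simp: norm_mult)
  have "c = (\<integral>\<zeta>. c \<partial>\<mu>)" by (simp add: prob_space)
  also have "\<dots> \<le> (\<integral>\<zeta>. Re (g (z * cnj \<zeta>)) \<partial>\<mu>)"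
    using i ge disc by (intro integral_mono) auto
  also have "\<dots> = Re (circle_transform \<mu> g z)" using i by (simp add: circle_transform_def)
  finally show ?thesis .
qed

section \<open>The class \<open>class_G\<close>\<close>

lemma euler_op_0 [simp]: "euler_op b g 0 = g 0"
  by (simp add: euler_op_def)

lemma euler_op_cong:
  assumes "\<And>z. z \<in> unit_disc \<Longrightarrow> g z = h z" "z \<in> unit_disc"
  shows "euler_op b g z = euler_op b h z"
proof -
  have "eventually (\<lambda>w. w \<in> unit_disc) (nhds z)"
    using assms(2) by (intro eventually_nhds_in_open) auto
  then have "deriv g z = deriv h z"
    by (intro deriv_cong_ev) (auto elim: eventually_mono simp: assms(1))
  then show ?thesis using assms by (simp add: euler_op_def)
qed

lemma euler_op_affine:
  assumes "g holomorphic_on unit_disc" "z \<in> unit_disc"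
  shows "euler_op b (\<lambda>w. c * g w + d) z = c * euler_op b g z + d"
proof -
  have "((\<lambda>w. c * g w + d) has_field_derivative c * deriv g z) (at z)"
    using holomorphic_derivI[OF assms(1) _ assms(2)] by (auto intro!: derivative_eq_intros)
  then show ?thesis by (simp add: euler_op_def DERIV_imp_deriv algebra_simps)
qed

text \<open>The integral formula recovers a function from its image under E.\<close>

lemma euler_op_inj:
  assumes "g holomorphic_on unit_disc" "h holomorphic_on unit_disc" "0 \<le> b"
    "\<And>z. z \<in> unit_disc \<Longrightarrow> euler_op b g z = euler_op b h z" "z \<in> unit_disc"
  shows "g z = h z"
  using has_integral_unique[OF euler_op_unique_integral[OF assms(1,3,4,5)] euler_op_integral[OF assms(2,3,5)]] .

text \<open>If g were not constant, its open image would contain \<open>g z - e\<close> for some e >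
  0, whose real part lies below c.\<close>

lemma Re_min_imp_constant:
  assumes g: "g holomorphic_on unit_disc" and ge: "\<And>z. z \<in> unit_disc \<Longrightarrow> c \<le> Re (g z)"
    and z: "z \<in> unit_disc" "Re (g z) = c" and w: "w \<in> unit_disc"
  shows "g w = g z"
proof -
  have "g constant_on unit_disc"
  proof (rule ccontr)
    assume "\<not> ?thesis"
    then have "open (g ` unit_disc)"
      using open_mapping_thm[OF g open_ball _ open_ball order_refl] by auto
    then obtain e where e: "e > 0" "cball (g z) e \<subseteq> g ` unit_disc"
      using z(1) open_contains_cball by blast
    then have "g z - of_real e \<in> g ` unit_disc" by (auto simp: dist_norm subset_iff)
    then have "c \<le> Re (g z - of_real e)" using ge by (metis imageE)
    then show False using z e by simp
  qed
  then show ?thesis using z w by (metis constant_on_def)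
qed

text \<open>\<open>class_P\<close> demands strict positivity while the bound on q is weak. The
  minimum principle supplies strictness for \<open>lam > 0\<close>, since \<open>q 0 = 1\<close>
  lies above \<open>1 - lam\<close>.\<close>

lemma affine_class_P:
  assumes q: "q holomorphic_on unit_disc" "q 0 = 1" and lam: "0 \<le> lam"
    and ge: "\<And>z. z \<in> unit_disc \<Longrightarrow> 1 - lam \<le> Re (q z)"
  obtains p where "p \<in> class_P" "\<And>z. z \<in> unit_disc \<Longrightarrow> q z = of_real lam * p z + of_real (1 - lam)"
proof (cases "lam = 0")
  \<comment> \<open>Division by \<open>lam\<close> is impossible here. The minimum principle makes q
    identically 1 and the identity then holds for every p, so the constant 1 is chosen.\<close>
  case True
  have "q z = 1" if "z \<in> unit_disc" for z
    using Re_min_imp_constant[OF q(1) ge, of 0 z] that q(2) True by simp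
  then show ?thesis by (intro that[of "\<lambda>_. 1"]) (auto simp: class_P_def True)
next
  case False
  define p where "p z = (q z - of_real (1 - lam)) / of_real lam" for z
  have "0 < Re (p z)" if z: "z \<in> unit_disc" for z
  proof -
    have "Re (q z) \<noteq> 1 - lam"
    proof
      assume eq: "Re (q z) = 1 - lam"
      have "q 0 = q z" by (rule Re_min_imp_constant[OF q(1) ge z eq]) auto
      then show False using eq q(2) False by simp
    qed
    then have "1 - lam < Re (q z)" using ge[OF z] by simp
    then show ?thesis using lam False by (simp add: p_def del: of_real_diff)
  qed
  moreover have "p holomorphic_on unit_disc"
    unfolding p_def[abs_def] using False by (intro holomorphic_intros q) auto
  ultimately show ?thesis
    using q False by (intro that[of p]) (auto simp: class_P_def p_def)
qed

section \<open>Passage from f to the quotient g with f = z g\<close>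

lemma quot_id_unique:
  assumes f: "f \<in> class_A" and g: "g holomorphic_on unit_disc"
    and fg: "\<And>z. z \<in> unit_disc \<Longrightarrow> f z = z * g z" and z: "z \<in> unit_disc"
  shows "quot_id f z = g z" and "deriv f z = g z + z * deriv g z"
proof -
  have "((\<lambda>w. w * g w) has_field_derivative g u + u * deriv g u) (at u)" if "u \<in> unit_disc" for u
    using holomorphic_derivI[OF g _ that] by (auto intro!: derivative_eq_intros)
  then have "(f has_field_derivative g u + u * deriv g u) (at u)" if "u \<in> unit_disc" for u
    by (rule has_field_derivative_transform_within_open[of _ _ u unit_disc]) (use that fg in auto)
  then have d: "deriv f u = g u + u * deriv g u" if "u \<in> unit_disc" for u
    using that DERIV_imp_deriv by blast
  show "deriv f z = g z + z * deriv g z" by (rule d[OF z])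
  show "quot_id f z = g z" using fg[OF z] d[of 0] by (simp add: quot_id_def)
qed

lemma quot_id_holomorphic:
  assumes f: "f \<in> class_A"
  shows "quot_id f holomorphic_on unit_disc"
proof -
  have "f holomorphic_on unit_disc" "f 0 = 0" using f by (auto simp: class_A_def)
  then obtain h where h: "h holomorphic_on unit_disc" "\<And>z. norm z < 1 \<Longrightarrow> f z = z * h z"
    using Schwarz3 by metis
  then show ?thesis
    using quot_id_unique(1)[OF f h(1)] holomorphic_cong[OF refl, of unit_disc h "quot_id f"] by simp
qed

lemma quot_id_mult: "f \<in> class_A \<Longrightarrow> f z = z * quot_id f z"
  by (simp add: quot_id_def class_A_def)

lemma class_A_deriv:
  assumes "f \<in> class_A" "z \<in> unit_disc"
  shows "deriv f z = quot_id f z + z * deriv (quot_id f) z"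
  using quot_id_unique(2)[OF assms(1) quot_id_holomorphic[OF assms(1)] quot_id_mult[OF assms(1)] assms(2)] .

lemma quot_id_0: "f \<in> class_A \<Longrightarrow> quot_id f 0 = 1"
  by (simp add: quot_id_def class_A_def)

text \<open>Substituting f = z g turns \<alpha> f/z + (1 - \<alpha>) f' into g + (1 - \<alpha>) z
  g'. The origin, excluded in \<open>class_G\<close>, can be added because E g takes the value 1
  there.\<close>

lemma class_G_iff:
  assumes f: "f \<in> class_A" and lam: "0 \<le> lam"
  shows "f \<in> class_G \<alpha> lam \<longleftrightarrow> (\<forall>z\<in>unit_disc. 1 - lam \<le> Re (euler_op (1 - \<alpha>) (quot_id f) z))"
proof -
  have eq: "of_real \<alpha> * (f z / z) + of_real (1 - \<alpha>) * deriv f z = euler_op (1 - \<alpha>) (quot_id f) z"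
    if "z \<in> unit_disc" "z \<noteq> 0" for z
    using that quot_id_mult[OF f, of z] by (simp add: class_A_deriv[OF f] euler_op_def algebra_simps)
  have "f \<in> class_G \<alpha> lam \<longleftrightarrow>
      (\<forall>z\<in>unit_disc - {0}. 1 - lam \<le> Re (euler_op (1 - \<alpha>) (quot_id f) z))"
    using f by (simp only: class_G_def mem_Collect_eq Ball_def Diff_iff singleton_iff eq simp_thms cong: imp_cong)
  moreover have "1 - lam \<le> Re (euler_op (1 - \<alpha>) (quot_id f) 0)"
    using lam quot_id_0[OF f] by simp
  ultimately show ?thesis by (metis Diff_iff singletonD)
qed

section \<open>The convolution criterion\<close>

text \<open>The rational part is \<alpha> times the sum of z^n plus 1 - \<alpha> times the sum of n
  z^n, over n >= 1. Its coefficient \<alpha> + (1 - \<alpha>) n equals 1 + (1 - \<alpha>) (n - 1),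
  the factor of E shifted by one because f = z g. The constant inside the bracket affects only n =
  1.\<close>

lemma conv_kernel_sums:
  fixes \<zeta> :: complex and lam \<alpha> :: real
  defines "c \<equiv> 2 * of_real lam * \<zeta> / (1 - \<zeta>)"
  assumes z: "z \<in> unit_disc"
  shows "(\<lambda>n. ((if n = 0 then 0 else of_real (\<alpha> + (1 - \<alpha>) * real n)) - (if n = 1 then 1 + c else 0)) * z ^ n)
    sums conv_kernel \<alpha> lam \<zeta> z"
proof -
  have nz: "1 - z \<noteq> 0" using z by (rule disc_one_minus_nz)
  have geo: "(\<lambda>n. 1 * w ^ n) sums (1 / (1 - w))" if "w \<in> unit_disc" for w :: complex
    using that by (simp add: geometric_sums)
  have "((\<lambda>w. 1 / (1 - w)) has_field_derivative 1 / (1 - z)\<^sup>2) (at z)"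
    using nz by (auto intro!: derivative_eq_intros simp: power2_eq_square)
  with power_series_derivative(2)[OF geo z]
  have s1: "(\<lambda>n. of_nat n * 1 * z ^ n) sums (z * (1 / (1 - z)\<^sup>2))" by (simp add: DERIV_imp_deriv)
  have s2: "(\<lambda>n. 1 * z ^ n - (if n = 0 then z ^ n else 0)) sums (1 / (1 - z) - z ^ 0)"
    by (intro sums_diff geo z sums_single)
  have s3: "(\<lambda>n. if n = 1 then (1 + c) * z ^ n else 0) sums ((1 + c) * z ^ 1)"
    by (rule sums_single)
  have "(\<lambda>n. of_real \<alpha> * (1 * z ^ n - (if n = 0 then z ^ n else 0)) + of_real (1 - \<alpha>) * (of_nat n * 1 * z ^ n)
      - (if n = 1 then (1 + c) * z ^ n else 0))
    sums (of_real \<alpha> * (1 / (1 - z) - z ^ 0) + of_real (1 - \<alpha>) * (z * (1 / (1 - z)\<^sup>2)) - (1 + c) * z ^ 1)"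
    by (intro sums_diff sums_add sums_mult s1 s2 s3)
  moreover have "of_real \<alpha> * (1 / (1 - z) - z ^ 0) + of_real (1 - \<alpha>) * (z * (1 / (1 - z)\<^sup>2)) - (1 + c) * z ^ 1
      = conv_kernel \<alpha> lam \<zeta> z"
  proof -
    have "of_real \<alpha> * (1 / (1 - z) - z ^ 0) + of_real (1 - \<alpha>) * (z * (1 / (1 - z)\<^sup>2)) =
        z * ((1 - of_real \<alpha> * z) / (1 - z)\<^sup>2)"
      using nz by (simp add: divide_simps power2_eq_square) (simp add: algebra_simps)
    then show ?thesis unfolding conv_kernel_def c_def[symmetric] by (simp add: algebra_simps)
  qed
  moreover have "of_real \<alpha> * (1 * z ^ n - (if n = 0 then z ^ n else 0)) + of_real (1 - \<alpha>) * (of_nat n * 1 * z ^ n)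
      - (if n = 1 then (1 + c) * z ^ n else 0) =
    ((if n = 0 then 0 else of_real (\<alpha> + (1 - \<alpha>) * real n)) - (if n = 1 then 1 + c else 0)) * z ^ n" for n
    by (simp add: algebra_simps)
  ultimately show ?thesis by simp
qed

lemma hadamard_conv_kernel:
  assumes f: "f \<in> class_A" and z: "z \<in> unit_disc"
  shows "hadamard f (conv_kernel \<alpha> lam \<zeta>) z =
    z * (euler_op (1 - \<alpha>) (quot_id f) z - (1 + 2 * of_real lam * \<zeta> / (1 - \<zeta>)))"
proof -
  define c where "c = 2 * of_real lam * \<zeta> / (1 - \<zeta>)"
  define a where "a = fps_nth (fps_expansion f 0)"
  have hol: "f holomorphic_on unit_disc" using f by (simp add: class_A_def)
  have a: "(\<lambda>n. a n * w ^ n) sums f w" if "w \<in> unit_disc" for w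
    unfolding a_def by (rule coeffs_sums[OF hol that])
  \<comment> \<open>The normalisation a_1 = 1 makes the correction at n = 1 the fixed term (1 + c)
    z, independent of f.\<close>
  have a01: "a 0 = 0" "a 1 = 1" using f by (auto simp: a_def fps_expansion_def class_A_def)
  have K: "fps_nth (fps_expansion (conv_kernel \<alpha> lam \<zeta>) 0) n =
      (if n = 0 then 0 else of_real (\<alpha> + (1 - \<alpha>) * real n)) - (if n = 1 then 1 + c else 0)" for n
    unfolding c_def by (rule coeffs_unique) (rule conv_kernel_sums)
  have "(\<lambda>n. of_real \<alpha> * (a n * z ^ n) + of_real (1 - \<alpha>) * (of_nat n * a n * z ^ n)
      - (if n = 1 then (1 + c) * z ^ n else 0))
    sums (of_real \<alpha> * f z + of_real (1 - \<alpha>) * (z * deriv f z) - (1 + c) * z ^ 1)"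
    by (intro sums_diff sums_add sums_mult a z power_series_derivative(2)[OF a z] sums_single)
  moreover have "of_real \<alpha> * (a n * z ^ n) + of_real (1 - \<alpha>) * (of_nat n * a n * z ^ n)
      - (if n = 1 then (1 + c) * z ^ n else 0) =
      fps_nth (fps_expansion f 0) n * fps_nth (fps_expansion (conv_kernel \<alpha> lam \<zeta>) 0) n * z ^ n" for n
    unfolding K a_def[symmetric] using a01 by (simp add: algebra_simps)
  ultimately have "hadamard f (conv_kernel \<alpha> lam \<zeta>) z =
      of_real \<alpha> * f z + of_real (1 - \<alpha>) * (z * deriv f z) - (1 + c) * z ^ 1"
    unfolding hadamard_def by (simp only: sums_iff)
  also have "\<dots> = z * (euler_op (1 - \<alpha>) (quot_id f) z - (1 + c))"
    unfolding class_A_deriv[OF f z] quot_id_mult[OF f, of z] euler_op_def by (simp add: algebra_simps)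
  finally show ?thesis unfolding c_def .
qed

lemma norm_eq_norm_one_plus_iff: "norm w = norm (1 + w) \<longleftrightarrow> Re w = - 1 / 2"
proof -
  have "norm w = norm (1 + w) \<longleftrightarrow> (norm w)\<^sup>2 = (norm (1 + w))\<^sup>2" by simp
  also have "\<dots> \<longleftrightarrow> Re w = - 1 / 2"
    unfolding cmod_power2 by (auto simp: power2_eq_square algebra_simps)
  finally show ?thesis .
qed

text \<open>Put v = \<zeta> / (1 - \<zeta>), so that 1 + v = 1 / (1 - \<zeta>) and \<zeta> = v / (1
  + v). Then |\<zeta>| = 1 means that v is equidistant from 0 and -1, which is the line Re v = -1/2,
  and 1 + 2 lam v moves this line to Re = 1 - lam.\<close>

lemma circle_image_line:
  assumes "0 < lam"
  shows "(\<exists>\<zeta>. norm \<zeta> = 1 \<and> \<zeta> \<noteq> 1 \<and> w = 1 + 2 * of_real lam * \<zeta> / (1 - \<zeta>)) \<longleftrightarrow> Re w = 1 - lam"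
proof
  assume "\<exists>\<zeta>. norm \<zeta> = 1 \<and> \<zeta> \<noteq> 1 \<and> w = 1 + 2 * of_real lam * \<zeta> / (1 - \<zeta>)"
  then obtain \<zeta> where \<zeta>: "norm \<zeta> = 1" "\<zeta> \<noteq> 1" "w = 1 + of_real (2 * lam) * (\<zeta> / (1 - \<zeta>))" by auto
  have "1 + \<zeta> / (1 - \<zeta>) = 1 / (1 - \<zeta>)" using \<zeta>(2) by (simp add: field_simps)
  then have "Re (\<zeta> / (1 - \<zeta>)) = - 1 / 2"
    using \<zeta> by (subst norm_eq_norm_one_plus_iff[symmetric]) (simp add: norm_divide)
  then show "Re w = 1 - lam" unfolding \<zeta>(3) by (simp only: plus_complex.sel Re_of_real_mult) simp
next
  assume re: "Re w = 1 - lam"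
  define v where "v = (w - 1) / of_real (2 * lam)"
  have v: "Re v = - 1 / 2" using re assms unfolding v_def Re_divide_of_real by simp
  then have n: "norm v = norm (1 + v)" by (simp add: norm_eq_norm_one_plus_iff)
  have nz: "1 + v \<noteq> 0" using v by (auto simp: complex_eq_iff)
  have "1 - v / (1 + v) = 1 / (1 + v)" using nz by (simp add: field_simps)
  then have "v / (1 + v) / (1 - v / (1 + v)) = v" using nz by simp
  moreover have "w = 1 + of_real (2 * lam) * v" using assms by (simp add: v_def)
  ultimately have "w = 1 + 2 * of_real lam * (v / (1 + v)) / (1 - v / (1 + v))"
    by (metis of_real_mult of_real_numeral times_divide_eq_right)
  moreover have "norm (v / (1 + v)) = 1" using n nz by (simp add: norm_divide)
  moreover have "v / (1 + v) \<noteq> 1" using nz by (simp add: field_simps)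
  ultimately show "\<exists>\<zeta>. norm \<zeta> = 1 \<and> \<zeta> \<noteq> 1 \<and> w = 1 + 2 * of_real lam * \<zeta> / (1 - \<zeta>)" by blast
qed

lemma class_G_iff_hadamard:
  assumes f: "f \<in> class_A" and lam: "0 < lam"
  shows "f \<in> class_G \<alpha> lam \<longleftrightarrow>
    (\<forall>\<zeta>. norm \<zeta> = 1 \<and> \<zeta> \<noteq> 1 \<longrightarrow> (\<forall>z\<in>unit_disc - {0}. hadamard f (conv_kernel \<alpha> lam \<zeta>) z \<noteq> 0))"
proof -
  define L where "L = euler_op (1 - \<alpha>) (quot_id f)"
  have L: "L holomorphic_on unit_disc" "L 0 = 1"
    unfolding L_def using quot_id_0[OF f] by (auto intro: euler_op_holomorphic quot_id_holomorphic[OF f])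
  have "(\<forall>\<zeta>. norm \<zeta> = 1 \<and> \<zeta> \<noteq> 1 \<longrightarrow> (\<forall>z\<in>unit_disc - {0}. hadamard f (conv_kernel \<alpha> lam \<zeta>) z \<noteq> 0))
    \<longleftrightarrow> (\<forall>z\<in>unit_disc - {0}. \<not> (\<exists>\<zeta>. norm \<zeta> = 1 \<and> \<zeta> \<noteq> 1 \<and> L z = 1 + 2 * of_real lam * \<zeta> / (1 - \<zeta>)))"
    using hadamard_conv_kernel[OF f] by (auto simp: L_def)
  also have "\<dots> \<longleftrightarrow> (\<forall>z\<in>unit_disc - {0}. Re (L z) \<noteq> 1 - lam)"
    unfolding circle_image_line[OF lam] ..
  also have "\<dots> \<longleftrightarrow> (\<forall>z\<in>unit_disc. 1 - lam \<le> Re (L z))"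
  proof
    assume ne: "\<forall>z\<in>unit_disc - {0}. Re (L z) \<noteq> 1 - lam"
    then have ne': "1 - lam \<notin> (\<lambda>z. Re (L z)) ` unit_disc" using L(2) lam by auto
    \<comment> \<open>The values of Re L form an interval that contains 1 and omits the smaller
      number \<open>1 - lam\<close>.\<close>
    have "connected ((\<lambda>z. Re (L z)) ` unit_disc)"
      by (intro connected_continuous_image continuous_intros holomorphic_on_imp_continuous_on L) auto
    moreover have "1 \<in> (\<lambda>z. Re (L z)) ` unit_disc" using L(2) by (force intro: image_eqI[of _ _ 0])
    ultimately show "\<forall>z\<in>unit_disc. 1 - lam \<le> Re (L z)"
      using ne' lam unfolding connected_iff_interval
      by (metis image_eqI less_imp_le linorder_le_cases less_add_same_cancel1 diff_less_eq)
  next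
    assume ge: "\<forall>z\<in>unit_disc. 1 - lam \<le> Re (L z)"
    show "\<forall>z\<in>unit_disc - {0}. Re (L z) \<noteq> 1 - lam"
    proof
      fix z assume z: "z \<in> unit_disc - {0}"
      show "Re (L z) \<noteq> 1 - lam"
      proof
        assume eq: "Re (L z) = 1 - lam"
        have "L 0 = L z" by (rule Re_min_imp_constant[OF L(1), of "1 - lam"]) (use ge z eq in auto)
        then show False using eq L(2) lam by simp
      qed
    qed
  qed
  finally show ?thesis using class_G_iff[OF f, of lam \<alpha>] lam by (simp add: L_def)
qed

text \<open>Forwards, q is E g itself; its strict positivity comes from
  \<open>affine_class_P\<close>, as a mixture of Re p > 0 and 1 with weights \<open>lam\<close> and
  \<open>1 - lam\<close>. Backwards, E g = q is solved by power series and the given integral is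
  recognised as g.\<close>

lemma class_G_iff_integral:
  assumes f: "f \<in> class_A" and \<alpha>: "\<alpha> \<le> 1" and lam: "0 \<le> lam" "lam \<le> 1"
  shows "f \<in> class_G \<alpha> lam \<longleftrightarrow>
    (\<exists>q\<in>class_P. (\<forall>z\<in>unit_disc. Re (q z) \<ge> 1 - lam) \<and>
      (\<forall>z\<in>unit_disc. f z = z * integral {0..1} (\<lambda>t::real. q (of_real (t powr (1 - \<alpha>)) * z))))"
proof
  let ?L = "euler_op (1 - \<alpha>) (quot_id f)"
  have hol: "quot_id f holomorphic_on unit_disc" by (rule quot_id_holomorphic[OF f])
  have L: "?L holomorphic_on unit_disc" "?L 0 = 1"
    using quot_id_0[OF f] by (auto intro: euler_op_holomorphic hol)
  assume "f \<in> class_G \<alpha> lam"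
  then have ge: "1 - lam \<le> Re (?L z)" if "z \<in> unit_disc" for z
    using class_G_iff[OF f lam(1)] that by blast
  obtain p where p: "p \<in> class_P" "\<And>z. z \<in> unit_disc \<Longrightarrow> ?L z = of_real lam * p z + of_real (1 - lam)"
    using affine_class_P[OF L lam(1) ge] by blast
  have "0 < Re (?L z)" if z: "z \<in> unit_disc" for z
  proof (cases "lam = 0")
    case False
    have "0 < Re (p z)" using p(1) z by (simp add: class_P_def)
    then have "0 < lam * Re (p z)" using False lam by simp
    then show ?thesis using p(2)[OF z] lam by simp
  qed (use p(2)[OF z] in simp)
  then have "?L \<in> class_P" using L by (simp add: class_P_def)
  moreover have "f z = z * integral {0..1} (\<lambda>t. ?L (of_real (t powr (1 - \<alpha>)) * z))" if "z \<in> unit_disc" for z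
    using quot_id_mult[OF f] integral_unique[OF euler_op_integral[OF hol _ that, of "1 - \<alpha>"]] \<alpha> by simp
  ultimately show "\<exists>q\<in>class_P. (\<forall>z\<in>unit_disc. Re (q z) \<ge> 1 - lam) \<and>
      (\<forall>z\<in>unit_disc. f z = z * integral {0..1} (\<lambda>t::real. q (of_real (t powr (1 - \<alpha>)) * z)))"
    using ge by blast
next
  assume "\<exists>q\<in>class_P. (\<forall>z\<in>unit_disc. Re (q z) \<ge> 1 - lam) \<and>
      (\<forall>z\<in>unit_disc. f z = z * integral {0..1} (\<lambda>t::real. q (of_real (t powr (1 - \<alpha>)) * z)))"
  then obtain q where q: "q holomorphic_on unit_disc" "\<And>z. z \<in> unit_disc \<Longrightarrow> 1 - lam \<le> Re (q z)"
    and fq: "\<And>z. z \<in> unit_disc \<Longrightarrow> f z = z * integral {0..1} (\<lambda>t::real. q (of_real (t powr (1 - \<alpha>)) * z))"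
    by (auto simp: class_P_def)
  have b: "0 \<le> 1 - \<alpha>" using \<alpha> by simp
  obtain g where g: "g holomorphic_on unit_disc" "\<And>z. z \<in> unit_disc \<Longrightarrow> euler_op (1 - \<alpha>) g z = q z"
    using euler_op_solvable[OF q(1) b] by blast
  have "f z = z * g z" if "z \<in> unit_disc" for z
    using fq[OF that] integral_unique[OF euler_op_unique_integral[OF g(1) b g(2) that]] by simp
  note quot_id_unique(1)[OF f g(1) this]
  then show "f \<in> class_G \<alpha> lam"
    using q(2) g(2) euler_op_cong[of "quot_id f" g] class_G_iff[OF f lam(1), of \<alpha>] by simp
qed

section \<open>The extremal functions, subordination and the integral representation\<close>

text \<open>The solution H of E H = F_one agrees with \<open>F_fun\<close> by the integral formula.
  For \<alpha> = 1 the operator is the identity, which matches the separate branch in the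
  definition.\<close>

lemma F_fun_euler:
  assumes \<alpha>: "\<alpha> \<le> 1"
  shows "F_fun \<alpha> holomorphic_on unit_disc"
    and "\<And>z. z \<in> unit_disc \<Longrightarrow> euler_op (1 - \<alpha>) (F_fun \<alpha>) z = F_one z"
proof -
  have b: "0 \<le> 1 - \<alpha>" using \<alpha> by simp
  obtain H where H: "H holomorphic_on unit_disc" "\<And>z. z \<in> unit_disc \<Longrightarrow> euler_op (1 - \<alpha>) H z = F_one z"
    using euler_op_solvable[OF F_one_holomorphic b] by blast
  have eq: "F_fun \<alpha> z = H z" if "z \<in> unit_disc" for z
    using integral_unique[OF euler_op_unique_integral[OF H(1) b H(2) that]] H(2)[OF that]
    by (cases "\<alpha> = 1") (simp_all add: F_fun_def euler_op_def)
  show "F_fun \<alpha> holomorphic_on unit_disc" by (rule holomorphic_transform[OF H(1)]) (simp add: eq)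
  show "euler_op (1 - \<alpha>) (F_fun \<alpha>) z = F_one z" if "z \<in> unit_disc" for z
    using euler_op_cong[OF eq that] H(2)[OF that] by simp
qed

lemma F_lam_euler:
  assumes \<alpha>: "\<alpha> \<le> 1"
  shows "F_lam \<alpha> lam holomorphic_on unit_disc"
    and "\<And>z. z \<in> unit_disc \<Longrightarrow> euler_op (1 - \<alpha>) (F_lam \<alpha> lam) z = of_real lam * F_one z + of_real (1 - lam)"
proof -
  show "F_lam \<alpha> lam holomorphic_on unit_disc"
    unfolding F_lam_def[abs_def] by (intro holomorphic_intros F_fun_euler(1)[OF \<alpha>])
  show "euler_op (1 - \<alpha>) (F_lam \<alpha> lam) z = of_real lam * F_one z + of_real (1 - lam)" if "z \<in> unit_disc" for z
    using euler_op_affine[OF F_fun_euler(1)[OF \<alpha>] that] F_fun_euler(2)[OF \<alpha> that]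
    unfolding F_lam_def[abs_def] by simp
qed

lemma class_G_affine:
  assumes f: "f \<in> class_G \<alpha> lam" and lam: "0 \<le> lam"
  obtains p where "p \<in> class_P"
    "\<And>z. z \<in> unit_disc \<Longrightarrow> euler_op (1 - \<alpha>) (quot_id f) z = of_real lam * p z + of_real (1 - lam)"
proof -
  have A: "f \<in> class_A" using f by (simp add: class_G_def)
  show ?thesis
    by (rule affine_class_P[OF euler_op_holomorphic[OF quot_id_holomorphic[OF A]] _ lam])
       (use that quot_id_0[OF A] f class_G_iff[OF A lam] in auto)
qed

text \<open>Since \<open>F_lam\<close> degenerates at \<open>lam = 0\<close>, the comparison is made
  between \<open>F_fun\<close> and the solution g of E g = p; the Schwarz function found there works
  for every \<open>lam\<close> after applying the same affine map to both sides.\<close>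

lemma class_G_subordinate:
  assumes f: "f \<in> class_G \<alpha> lam" and \<alpha>: "\<alpha> \<le> 1" and lam: "0 \<le> lam"
  shows "subordinate (quot_id f) (F_lam \<alpha> lam)"
proof -
  have b: "0 \<le> 1 - \<alpha>" using \<alpha> by simp
  have A: "f \<in> class_A" using f by (simp add: class_G_def)
  note hol = quot_id_holomorphic[OF A]
  obtain p where p: "p \<in> class_P"
      "\<And>z. z \<in> unit_disc \<Longrightarrow> euler_op (1 - \<alpha>) (quot_id f) z = of_real lam * p z + of_real (1 - lam)"
    using class_G_affine[OF f lam] by blast
  have p': "p holomorphic_on unit_disc" "p 0 = 1" "\<And>z. z \<in> unit_disc \<Longrightarrow> 0 < Re (p z)"
    using p(1) by (auto simp: class_P_def)
  obtain g where g: "g holomorphic_on unit_disc" "\<And>z. z \<in> unit_disc \<Longrightarrow> euler_op (1 - \<alpha>) g z = p z"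
    using euler_op_solvable[OF p'(1) b] by blast
  have "g 0 = 1" using g(2)[of 0] p'(2) by simp
  then obtain v where v: "v holomorphic_on unit_disc" "v ` unit_disc \<subseteq> unit_disc" "v 0 = 0"
      "\<And>z. z \<in> unit_disc \<Longrightarrow> g z = F_fun \<alpha> (v z)"
    using subordination[OF F_fun_euler(1)[OF \<alpha>] b F_fun_euler(2)[OF \<alpha>] g(1)] g(2) p'(3) by auto
  have "quot_id f z = of_real lam * g z + of_real (1 - lam)" if "z \<in> unit_disc" for z
  proof (rule euler_op_inj[OF hol _ b _ that])
    show "(\<lambda>z. of_real lam * g z + of_real (1 - lam)) holomorphic_on unit_disc"
      by (intro holomorphic_intros g)
    show "euler_op (1 - \<alpha>) (quot_id f) z = euler_op (1 - \<alpha>) (\<lambda>z. of_real lam * g z + of_real (1 - lam)) z"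
      if "z \<in> unit_disc" for z
      unfolding euler_op_affine[OF g(1) that] p(2)[OF that] g(2)[OF that] ..
  qed
  then have "\<forall>z\<in>unit_disc. quot_id f z = F_lam \<alpha> lam (v z)"
    using v(4) by (simp add: F_lam_def)
  then show ?thesis
    unfolding subordinate_def using hol F_lam_euler(1)[OF \<alpha>] v(1,2,3) by blast
qed

text \<open>Applying E to the average of \<open>F_lam\<close> gives the average of
  \<open>lam * F_one + (1 - lam)\<close>. Its real part is at least \<open>1 - lam\<close>;
  conversely the Herglotz measure of p makes it equal to E (f/z), and injectivity of E removes the
  operator.\<close>

lemma class_G_iff_measure:
  assumes f: "f \<in> class_A" and \<alpha>: "\<alpha> \<le> 1" and lam: "0 \<le> lam"
  shows "f \<in> class_G \<alpha> lam \<longleftrightarrow>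
    (\<exists>\<mu>. prob_space \<mu> \<and> sets \<mu> = sets circle_borel \<and>
      (\<forall>z\<in>unit_disc. f z = z * circle_transform \<mu> (F_lam \<alpha> lam) z))"
proof
  have b: "0 \<le> 1 - \<alpha>" using \<alpha> by simp
  note F = F_lam_euler[OF \<alpha>, where lam=lam]
  assume G: "f \<in> class_G \<alpha> lam"
  obtain p where p: "p \<in> class_P"
      "\<And>z. z \<in> unit_disc \<Longrightarrow> euler_op (1 - \<alpha>) (quot_id f) z = of_real lam * p z + of_real (1 - lam)"
    using class_G_affine[OF G lam] by blast
  then obtain \<mu> where \<mu>: "prob_space \<mu>" "sets \<mu> = sets circle_borel"
      "\<And>z. z \<in> unit_disc \<Longrightarrow> circle_transform \<mu> F_one z = p z"
    using Herglotz[of p] by (auto simp: class_P_def)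
  have "quot_id f z = circle_transform \<mu> (F_lam \<alpha> lam) z" if "z \<in> unit_disc" for z
  proof (rule euler_op_inj[OF quot_id_holomorphic[OF f] circle_transform_holomorphic[OF \<mu>(1,2) F(1)] b _ that])
    fix z assume z: "z \<in> unit_disc"
    have "circle_transform \<mu> (euler_op (1 - \<alpha>) (F_lam \<alpha> lam)) z =
        circle_transform \<mu> (\<lambda>w. of_real lam * F_one w + of_real (1 - lam)) z"
      unfolding circle_transform_def
    proof (rule Bochner_Integration.integral_cong[OF refl])
      fix \<zeta> assume "\<zeta> \<in> space \<mu>"
      then have "z * cnj \<zeta> \<in> unit_disc"
        using z by (simp add: space_circle_measure[OF \<mu>(2)] norm_mult)
      then show "euler_op (1 - \<alpha>) (F_lam \<alpha> lam) (z * cnj \<zeta>) =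
          of_real lam * F_one (z * cnj \<zeta>) + of_real (1 - lam)"
        by (rule F(2))
    qed
    also have "\<dots> = euler_op (1 - \<alpha>) (quot_id f) z"
      unfolding circle_transform_affine[OF \<mu>(1,2) F_one_holomorphic z] \<mu>(3)[OF z] p(2)[OF z] ..
    finally show "euler_op (1 - \<alpha>) (quot_id f) z = euler_op (1 - \<alpha>) (circle_transform \<mu> (F_lam \<alpha> lam)) z"
      unfolding euler_op_circle_transform[OF \<mu>(1,2) F(1) z] by simp
  qed
  then show "\<exists>\<mu>. prob_space \<mu> \<and> sets \<mu> = sets circle_borel \<and>
      (\<forall>z\<in>unit_disc. f z = z * circle_transform \<mu> (F_lam \<alpha> lam) z)"
    using \<mu>(1,2) quot_id_mult[OF f] by metis
next
  note F = F_lam_euler[OF \<alpha>, where lam=lam]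
  assume "\<exists>\<mu>. prob_space \<mu> \<and> sets \<mu> = sets circle_borel \<and>
      (\<forall>z\<in>unit_disc. f z = z * circle_transform \<mu> (F_lam \<alpha> lam) z)"
  then obtain \<mu> where \<mu>: "prob_space \<mu>" "sets \<mu> = sets circle_borel"
    and rep: "\<And>z. z \<in> unit_disc \<Longrightarrow> f z = z * circle_transform \<mu> (F_lam \<alpha> lam) z" by blast
  let ?g = "circle_transform \<mu> (F_lam \<alpha> lam)"
  have q: "quot_id f z = ?g z" if "z \<in> unit_disc" for z
    by (rule quot_id_unique(1)[OF f circle_transform_holomorphic[OF \<mu> F(1)] rep that])
  have eq: "euler_op (1 - \<alpha>) (quot_id f) z = circle_transform \<mu> (euler_op (1 - \<alpha>) (F_lam \<alpha> lam)) z"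
    if z: "z \<in> unit_disc" for z
    using euler_op_cong[OF q z] euler_op_circle_transform[OF \<mu> F(1) z] by simp
  have "1 - lam \<le> Re (euler_op (1 - \<alpha>) (quot_id f) z)" if z: "z \<in> unit_disc" for z
    unfolding eq[OF z]
  proof (rule Re_circle_transform_ge[OF \<mu> euler_op_holomorphic[OF F(1)] z])
    fix w assume w: "w \<in> unit_disc"
    show "1 - lam \<le> Re (euler_op (1 - \<alpha>) (F_lam \<alpha> lam) w)"
      using Re_F_one_pos[OF w] lam by (simp add: F(2)[OF w])
  qed
  then show "f \<in> class_G \<alpha> lam" using class_G_iff[OF f lam] by blast
qed

theorem theorem4p20:
  fixes \<alpha> lam :: real and f :: "complex \<Rightarrow> complex"
  assumes "\<alpha> \<le> 1" and "0 \<le> lam" and "lam \<le> 1" and "f \<in> class_A"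
  shows "(0 < lam \<longrightarrow>
            (f \<in> class_G \<alpha> lam \<longleftrightarrow>
              (\<forall>\<zeta>. norm \<zeta> = 1 \<and> \<zeta> \<noteq> 1 \<longrightarrow>
                 (\<forall>z\<in>unit_disc - {0}. hadamard f (conv_kernel \<alpha> lam \<zeta>) z \<noteq> 0)))) \<and>
         (f \<in> class_G \<alpha> lam \<longleftrightarrow>
            (\<exists>q\<in>class_P. (\<forall>z\<in>unit_disc. Re (q z) \<ge> 1 - lam) \<and>
               (\<forall>z\<in>unit_disc.
                  f z = z * integral {0..1} (\<lambda>t::real. q (of_real (t powr (1 - \<alpha>)) * z))))) \<and>
         (f \<in> class_G \<alpha> lam \<longrightarrow> subordinate (quot_id f) (F_lam \<alpha> lam)) \<and>
         (f \<in> class_G \<alpha> lam \<longleftrightarrow>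
            (\<exists>\<mu>::complex measure. prob_space \<mu> \<and>
               sets \<mu> = sets (restrict_space borel (sphere 0 1)) \<and>
               (\<forall>z\<in>unit_disc. f z = z * (\<integral>\<zeta>. F_lam \<alpha> lam (z * cnj \<zeta>) \<partial>\<mu>))))"
  using class_G_iff_hadamard[OF assms(4), of lam \<alpha>] class_G_iff_integral[OF assms(4,1,2,3)]
    class_G_subordinate[OF _ assms(1,2), of f]
    class_G_iff_measure[OF assms(4,1,2), unfolded circle_transform_def]
  by blast

end
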